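(* Let $k\geq 2$ be an integer and $\mathrm{Re}(s)>0$. Then $$\mathcal{F}_k(s)=\frac12\zeta(ks)+\frac{\zeta(ks-(k-1))}{s-1}+\frac{s}{12}\zeta(ks+k-1)-\frac{s(s+1)}{2\pi^2}\sum_{n=1}^\infty\frac{\sigma^{(k-1)}_{k-1-ks}(n)}{n^2}\int_1^\infty\cos(2\pi nx)\,x^{-s-2}\,dx,$$ where $\mathcal{F}_k$ denotes the meromorphic continuation of the Dirichlet series below.
   Context: For $k\in\mathbb{N}$, $d^{(1/k)}(n):=\#\{d\in\mathbb{N}: d\mid n,\ d\leq n^{1/k}\}$ and, for $\mathrm{Re}(s)>1$, $\mathcal{F}_k(s):=\sum_{j\ge1} d^{(1/k)}(j)j^{-s}=\sum_{m\ge1,n\ge0}(m^k+mn)^{-s}$ (extended meromorphically to $\mathbb{C}$). For $k\in\mathbb{N}$ and $z\in\mathbb{C}$, $\sigma^{(k)}_z(n):=\sum_{d\in\mathbb{N},\, d^k\mid n} d^z$. $\zeta$ is the Riemann zeta function. *)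

theory Defs
  imports "HOL-Complex_Analysis.Complex_Analysis"
begin

text \<open>
  The meromorphic continuation to \<open>\<complex>\<close> of a function \<open>f\<close> given on \<open>A\<close>. The predicate
  \<open>nicely_meromorphic_on\<close> fixes the values at isolated singularities (removable ones are
  removed, and the value at a pole is \<open>0\<close>), so that the continuation is unique as a
  HOL function; see \<open>meromorphic_continuation_unique\<close> below.
\<close>

definition meromorphic_continuation ::
  "(complex \<Rightarrow> complex) \<Rightarrow> complex set \<Rightarrow> complex \<Rightarrow> complex" where
  "meromorphic_continuation f A =
     (THE g. g nicely_meromorphic_on UNIV \<and> (\<forall>s\<in>A. g s = f s))"

definition zeta :: "complex \<Rightarrow> complex" where
  "zeta = meromorphic_continuation
     (\<lambda>s. \<Sum>n. of_nat (Suc n) powr (-s)) {s. Re s > 1}"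

text \<open>\<open>root_divisor_count k n\<close> is $d^{(1/k)}(n)$, for \<open>k, n \<ge> 1\<close>.\<close>

definition root_divisor_count :: "nat \<Rightarrow> nat \<Rightarrow> nat" where
  "root_divisor_count k n =
     card {d::nat. d > 0 \<and> d dvd n \<and> real d \<le> real n powr (1 / real k)}"

text \<open>\<open>F_cont k\<close> is $\mathcal{F}_k$, continued to the whole plane.\<close>

definition F_cont :: "nat \<Rightarrow> complex \<Rightarrow> complex" where
  "F_cont k = meromorphic_continuation
     (\<lambda>s. \<Sum>j. of_nat (root_divisor_count k (Suc j)) * of_nat (Suc j) powr (-s)) {s. Re s > 1}"

text \<open>\<open>sigma_pow k z n\<close> is $\sigma^{(k)}_z(n)$, for \<open>k, n \<ge> 1\<close> (the index set is then finite).\<close>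

definition sigma_pow :: "nat \<Rightarrow> complex \<Rightarrow> nat \<Rightarrow> complex" where
  "sigma_pow k z n = (\<Sum>d | d > 0 \<and> d ^ k dvd n. of_nat d powr z)"

lemma nicely_meromorphic_eqI:
  assumes g: "g nicely_meromorphic_on UNIV" and h: "h nicely_meromorphic_on UNIV"
    and A: "open A" "A \<noteq> {}" and eq: "\<And>s. s \<in> A \<Longrightarrow> g s = h s"
  shows "g = h"
proof
  fix z
  define d where "d = remove_sings (\<lambda>s. g s - h s)"
  have mer: "(\<lambda>s. g s - h s) meromorphic_on UNIV"
    using g h by (auto simp: nicely_meromorphic_on_def intro!: meromorphic_intros)
  have d: "d nicely_meromorphic_on UNIV"
    unfolding d_def by (rule remove_sings_nicely_meromorphic[OF mer])
  have d0: "d s = 0" if "s \<in> A" for s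
    unfolding d_def
  proof (rule remove_sings_eqI)
    have "\<forall>\<^sub>F w in at s. g w - h w = 0"
      using eventually_at_in_open'[OF A(1) that] by eventually_elim (use eq in auto)
    thus "(\<lambda>s. g s - h s) \<midarrow>s\<rightarrow> 0" by (rule tendsto_eventually)
  qed
  have "d constant_on UNIV"
    by (rule constant_on_extend_nicely_meromorphic_on[OF d _ A(1) open_UNIV _ A(2)])
       (use d0 in \<open>auto simp: constant_on_def\<close>)
  hence dz: "d w = 0" for w
    using d0 A(2) by (auto simp: constant_on_def)
  have "isolated_singularity_at (\<lambda>s. g s - h s) z"
    using mer meromorphic_on_subset[of _ UNIV "{z}"] by (simp add: meromorphic_at_iff)
  from eventually_remove_sings_eq_at[OF this]
  have ev: "\<forall>\<^sub>F w in at z. g w = h w"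
    by eventually_elim (use dz in \<open>simp add: d_def\<close>)
  have G: "is_pole g z \<and> g z = 0 \<or> g \<midarrow>z\<rightarrow> g z" and H: "is_pole h z \<and> h z = 0 \<or> h \<midarrow>z\<rightarrow> h z"
    using g h by (auto simp: nicely_meromorphic_on_def)
  have "is_pole g z \<longleftrightarrow> is_pole h z"
    by (rule is_pole_cong[OF ev refl])
  moreover have "g \<midarrow>z\<rightarrow> c \<longleftrightarrow> h \<midarrow>z\<rightarrow> c" for c
    by (rule tendsto_cong[OF ev])
  ultimately show "g z = h z"
    using G H is_pole_tendsto LIM_unique not_tendsto_and_filterlim_at_infinity
    by (metis is_pole_def trivial_limit_at)
qed

lemma meromorphic_continuation_unique:
  assumes "g nicely_meromorphic_on UNIV" "open A" "A \<noteq> {}" "\<And>s. s \<in> A \<Longrightarrow> g s = f s"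
  shows "meromorphic_continuation f A = g"
  unfolding meromorphic_continuation_def
proof (rule the_equality)
  fix h assume "h nicely_meromorphic_on UNIV \<and> (\<forall>s\<in>A. h s = f s)"
  thus "h = g" using assms nicely_meromorphic_eqI[of h g A] by auto
qed (use assms in auto)

end

theory Submission
  imports Defs
begin

text \<open>
  Summing first over the second variable, $\mathcal{F}_k(s)$ is a sum over $m$ of $m^{-s}$ times the Hurwitz
  zeta function at the integer $m^{k-1}$. Second-order Euler--Maclaurin summation, with the Fourier
  series of the periodic Bernoulli function $B_2$ inserted, expresses the latter by three powers of
  $m$ and by the integrals $I(nm^{k-1}, s)$, where
  $I(N, s) = \int_1^\infty \cos(2\pi Nx) x^{-s-2} dx$; regrouping by $N = nm^{k-1}$ gives the formula
  for $\mathrm{Re}(s) > 1$, and its right-hand side is analytic for $\mathrm{Re}(s) > 0$ off $1$ and $1/k$.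

  The continuation to the whole plane comes from the same formula. Integrating by parts twice gives
  $I(N, s) = (s+2)(2\pi N)^{-2}(1 - (s+3) I(N, s+2))$, so $\sum_N c_N(s) N^{-2} I(N, s)$
  is a finite combination of the Dirichlet series $\sum_N c_N(s) N^{-2j-4}$ and of
  $\sum_N c_N(s) N^{-2J-2} I(N, s+2J)$, which converges in any given half-plane once $J$ is large.
  For $c_N = 1$ this continues $\zeta$; for $c_N = \sigma^{(k-1)}_{k-1-ks}(N)$ the Dirichlet
  series are products of two values of $\zeta$, and it continues $\mathcal{F}_k$.
\<close>

section \<open>Gluing meromorphic functions on half-planes\<close>

text \<open>\<open>zeta\<close> and \<open>F_cont\<close> are definite descriptions, so nothing is
  known about their values until a nicely meromorphic function on the whole plane has been exhibited
  that agrees with the series for Re s > 1. This is why a formula for Re s > 0 needs a continuation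
  to the left as well. No fixed number of integrations by parts reaches the whole plane: the shifted
  integral exists only in a shifted half-plane, and the bound on the coefficients c_N(s) worsens as
  Re s decreases. So there is one function for each half-plane, and these have to be glued. The
  order two of the summation matters: with Fourier coefficients 1/n^2 the trivial bound on the
  integral already makes the double series in m and n absolutely convergent, so it may be regrouped
  freely. At s = 1 and s = 1/k terms on the right have poles, and the values that HOL assigns there
  (0 at a pole, 0 for a division by 0) need not balance; hence these points are excluded.\<close>

lemma nicely_meromorphic_eq_on:
  assumes g: "g nicely_meromorphic_on U" and h: "h nicely_meromorphic_on U"
    and U: "open U" "connected U" and A: "open A" "A \<noteq> {}" "A \<subseteq> U"
    and eq: "\<And>s. s \<in> A \<Longrightarrow> g s = h s" and z: "z \<in> U"
  shows "g z = h z"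
proof -
  define d where "d = remove_sings (\<lambda>s. g s - h s)"
  have mer: "(\<lambda>s. g s - h s) meromorphic_on U"
    using g h by (auto simp: nicely_meromorphic_on_def intro!: meromorphic_intros)
  have d: "d nicely_meromorphic_on U"
    unfolding d_def by (rule remove_sings_nicely_meromorphic[OF mer])
  have d0: "d s = 0" if "s \<in> A" for s
    unfolding d_def
    by (rule remove_sings_eqI, rule tendsto_eventually)
       (use eventually_at_in_open'[OF A(1) that] eq in \<open>auto elim!: eventually_mono\<close>)
  hence "d constant_on U"
    using constant_on_extend_nicely_meromorphic_on[OF d _ A(1) U A(2,3)]
    by (auto simp: constant_on_def)
  hence dz: "d w = 0" if "w \<in> U" for w
    using d0 A that unfolding constant_on_def by (metis all_not_in_conv subsetD)
  have "isolated_singularity_at (\<lambda>s. g s - h s) z"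
    using mer z by (auto simp: meromorphic_on_altdef)
  from eventually_remove_sings_eq_at[OF this] eventually_at_in_open'[OF U(1) z]
  have ev: "\<forall>\<^sub>F w in at z. g w = h w"
    by eventually_elim (use dz in \<open>simp add: d_def\<close>)
  \<comment> \<open>So far the functions agree only in a punctured neighbourhood of
    \<open>z\<close>. \<open>remove_sings\<close> sees nothing more than that and fixes nicely
    meromorphic functions, which carries the equality to \<open>z\<close> itself, poles
    included.\<close>
  have "remove_sings g z = remove_sings h z"
    by (rule remove_sings_cong[OF ev refl])
  moreover have "remove_sings f z = f z" if "f nicely_meromorphic_on U" for f
    using that z by (auto simp: nicely_meromorphic_on_def)
  ultimately show ?thesis using g h by simp
qed

text \<open>The half-planes increase and exhaust the plane, and all \<open>h n\<close> equal
  \<open>f\<close> where Re s > 1; by the identity theorem any two of them agree on the smaller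
  half-plane up to isolated corrections. So \<open>g\<close> takes the values of
  \<open>remove_sings (h n)\<close>, and equality with \<open>h n s\<close> itself is promised only
  where \<open>h n\<close> is analytic.\<close>

lemma nicely_meromorphic_glue:
  fixes h :: "nat \<Rightarrow> complex \<Rightarrow> complex"
  assumes mer: "\<And>n. h n meromorphic_on {s. Re s > - real n}"
    and eq: "\<And>n s. Re s > 1 \<Longrightarrow> h n s = f s"
  obtains g where "g nicely_meromorphic_on UNIV"
    "\<And>n s. Re s > - real n \<Longrightarrow> h n analytic_on {s} \<Longrightarrow> g s = h n s"
    "\<And>n s. Re s > - real n \<Longrightarrow> h n analytic_on {s} \<Longrightarrow> g analytic_on {s}"
proof -
  define U where "U n = {s. Re s > - real n}" for n
  define H where "H n = remove_sings (h n)" for n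
  define N where "N s = nat \<lceil>\<bar>Re s\<bar>\<rceil> + 1" for s
  define g where "g s = H (N s) s" for s
  have U: "open (U n)" "connected (U n)" for n
    unfolding U_def by (auto simp: open_halfspace_Re_gt convex_halfspace_Re_gt intro!: convex_connected)
  have NU: "s \<in> U (N s)" for s
    unfolding U_def N_def by simp linarith
  have A: "open {s. Re s > 1}" "{s. Re s > 1} \<noteq> {}" "{s. Re s > 1} \<subseteq> U n" for n
    by (auto simp: U_def open_halfspace_Re_gt intro!: exI[of _ 2])
  have Hn: "H n nicely_meromorphic_on U n" for n
    unfolding H_def U_def by (rule remove_sings_nicely_meromorphic[OF mer])
  have Heq: "H m s = H n s" if "Re s > 1" for m n s
  proof -
    have "\<forall>\<^sub>F w in at s. h m w = h n w"
      using eventually_at_in_open'[OF A(1), of s] that by (auto elim!: eventually_mono simp: eq)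
    thus ?thesis unfolding H_def by (rule remove_sings_cong) simp
  qed
  have mono: "U m \<subseteq> U n" if "m \<le> n" for m n
    using that by (auto simp: U_def)
  have HH: "H m s = H n s" if "s \<in> U m" "m \<le> n" for m n s
    by (rule nicely_meromorphic_eq_on[OF Hn nicely_meromorphic_on_subset[OF Hn mono[OF that(2)]] U A])
       (use that Heq in auto)
  have gH: "g s = H n s" if "s \<in> U n" for s n
    unfolding g_def using HH[of s n "N s"] HH[of s "N s" n] that NU[of s] by (metis nat_le_linear)
  have ev: "\<forall>\<^sub>F w in nhds s. g w = H n w" if "s \<in> U n" for s n
    using eventually_nhds_in_open[OF U(1) that] by eventually_elim (rule gH)
  have nice: "g nicely_meromorphic_on UNIV"
    unfolding nicely_meromorphic_on_def
  proof safe
    have "g meromorphic_on U n" for n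
      using Hn[of n] ev meromorphic_on_cong[of "U n" g "H n", OF _ refl]
      by (simp add: nicely_meromorphic_on_def eventually_nhds_conv_at)
    thus "g meromorphic_on UNIV"
      using NU by (meson UNIV_I meromorphic_on_def)
  next
    fix z assume *: "\<not> g \<midarrow>z\<rightarrow> g z"
    have e: "\<forall>\<^sub>F w in at z. g w = H (N z) w" "g z = H (N z) z"
      using ev[OF NU] by (auto simp: eventually_nhds_conv_at g_def)
    have "(is_pole (H (N z)) z \<and> H (N z) z = 0) \<or> H (N z) \<midarrow>z\<rightarrow> H (N z) z"
      using Hn[of "N z"] NU[of z] by (auto simp: nicely_meromorphic_on_def)
    with * have "is_pole g z \<and> g z = 0"
      using is_pole_cong[OF e(1) refl] tendsto_cong[OF e(1)] e(2) by simp
    thus "is_pole g z" "g z = 0" by auto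
  qed
  show thesis
  proof (rule that[OF nice])
    fix n s assume s: "Re s > - real n" and an: "h n analytic_on {s}"
    have s': "s \<in> U n" using s by (simp add: U_def)
    show "g s = h n s" using gH[OF s'] an by (simp add: H_def)
    have "H n analytic_on {s}" unfolding H_def by (rule remove_sings_analytic_on[OF an])
    thus "g analytic_on {s}" using analytic_at_cong[OF ev[OF s'] refl] by simp
  qed
qed

section \<open>The oscillatory integral\<close>

lemma integral_tail_powr_bound:
  fixes f :: "real \<Rightarrow> complex"
  assumes a: "a > 0" and p: "p > 1" and cont: "continuous_on {a..} f"
    and bound: "\<And>x. x \<ge> a \<Longrightarrow> norm (f x) \<le> C * x powr (-p)"
  shows "f integrable_on {a..}"
    and "norm (integral {a..} f) \<le> C * (a powr (1 - p) / (p - 1))"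
proof -
  have hi: "((\<lambda>x. C * x powr (-p)) has_integral C * (a powr (1 - p) / (p - 1))) {a..}"
  proof -
    have "- (a powr (- p + 1)) / (- p + 1) = a powr (1 - p) / (p - 1)"
      using p by (simp add: field_simps)
    thus ?thesis
      using has_integral_mult_right[OF has_integral_powr_to_inf[of "-p" a], of C] a p by simp
  qed
  show int: "f integrable_on {a..}"
  proof (rule measurable_bounded_by_integrable_imp_integrable)
    show "f \<in> borel_measurable (lebesgue_on {a..})"
      by (rule continuous_imp_measurable_on_sets_lebesgue[OF cont]) simp
    show "(\<lambda>x. C * x powr (-p)) integrable_on {a..}" using hi by blast
  qed (use bound in auto)
  show "norm (integral {a..} f) \<le> C * (a powr (1 - p) / (p - 1))"
    using integral_norm_bound_integral[OF int has_integral_integrable[OF hi] bound]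
    unfolding integral_unique[OF hi] by simp
qed

lemma integral_atLeast_split:
  fixes f :: "real \<Rightarrow> complex"
  assumes ab: "a \<le> b" and int: "f integrable_on {b..}" and cont: "continuous_on {a..b} f"
  shows "integral {a..} f = integral {a..b} f + integral {b..} f"
proof -
  have "(f has_integral (integral {a..b} f + integral {b..} f)) ({a..b} \<union> {b..})"
  proof (rule has_integral_Un)
    have "{a..b} \<inter> {b..} = {b}" using ab by auto
    thus "negligible ({a..b} \<inter> {b..})" by simp
  qed (use int integrable_continuous_real[OF cont] in \<open>auto intro: integrable_integral\<close>)
  moreover have "{a..b} \<union> {b..} = {a..}" using ab by auto
  ultimately show ?thesis by (simp add: integral_unique)
qed

text \<open>Antiderivatives and substitutions are applied on compact intervals; this limit carries
  the resulting identities over to the half-line.\<close>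

lemma integral_tail_powr_tendsto:
  fixes f :: "real \<Rightarrow> complex"
  assumes a: "a > 0" and p: "p > 1" and cont: "continuous_on {a..} f"
    and bound: "\<And>x. x \<ge> a \<Longrightarrow> norm (f x) \<le> C * x powr (-p)"
  shows "((\<lambda>b. integral {a..b} f) \<longlongrightarrow> integral {a..} f) at_top"
proof (rule Lim_transform2)
  show "((\<lambda>b. integral {a..} f) \<longlongrightarrow> integral {a..} f) at_top" by simp
  have "((\<lambda>b. C * (b powr (1 - p) / (p - 1))) \<longlongrightarrow> C * (0 / (p - 1))) at_top"
    using p by (intro tendsto_intros tendsto_neg_powr filterlim_ident) auto
  hence lim: "((\<lambda>b. C * (b powr (1 - p) / (p - 1))) \<longlongrightarrow> 0) at_top" by simp
  show "((\<lambda>b. integral {a..} f - integral {a..b} f) \<longlongrightarrow> 0) at_top"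
  proof (rule Lim_null_comparison[OF _ lim])
    show "\<forall>\<^sub>F b in at_top. norm (integral {a..} f - integral {a..b} f) \<le> C * (b powr (1 - p) / (p - 1))"
      using eventually_ge_at_top[of a]
    proof eventually_elim
      case (elim b)
      have c: "continuous_on {b..} f" by (rule continuous_on_subset[OF cont]) (use elim in auto)
      note t = integral_tail_powr_bound[of b p f C, OF _ p c bound]
      have "integral {a..} f = integral {a..b} f + integral {b..} f"
        by (rule integral_atLeast_split[OF elim t(1)])
           (use elim a in \<open>auto intro: continuous_on_subset[OF cont]\<close>)
      thus ?case using t(2) elim a by simp
    qed
  qed
qed

lemma norm_of_real_powr:
  "x > 0 \<Longrightarrow> norm (of_real x powr z :: complex) = x powr Re z"
  by (simp add: norm_powr_real_powr)

text \<open>The integral converges for \<open>Re s > -1\<close> only.\<close>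

definition osc :: "nat \<Rightarrow> complex \<Rightarrow> complex" where
  "osc n s = integral {1..} (\<lambda>x. of_real (cos (2 * pi * real n * x)) * of_real x powr (- s - 2))"

lemma continuous_on_cos_powr:
  assumes "a > 0"
  shows "continuous_on {a..b} (\<lambda>x. of_real (cos (w * x)) * of_real x powr z :: complex)"
    "continuous_on {a..} (\<lambda>x. of_real (cos (w * x)) * of_real x powr z :: complex)"
  using assms by (auto intro!: continuous_intros)

lemma norm_cos_powr_le:
  assumes "x > 0"
  shows "norm (of_real (cos (w * x)) * of_real x powr z :: complex) \<le> x powr Re z"
proof -
  have "norm (of_real (cos (w * x)) * of_real x powr z :: complex) = \<bar>cos (w * x)\<bar> * x powr Re z"
    using assms by (simp add: norm_mult norm_of_real_powr)
  also have "\<dots> \<le> 1 * x powr Re z" by (intro mult_right_mono) auto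
  finally show ?thesis by simp
qed

lemma cos_powr_integral_bound:
  assumes "Re s > -1" "a > 0"
  shows "(\<lambda>x. of_real (cos (w * x)) * of_real x powr (- s - 2) :: complex) integrable_on {a..}"
    and "norm (integral {a..} (\<lambda>x. of_real (cos (w * x)) * of_real x powr (- s - 2) :: complex))
           \<le> a powr (- Re s - 1) / (Re s + 1)"
proof -
  note * = integral_tail_powr_bound[of a "Re s + 2" "\<lambda>x. of_real (cos (w * x)) * of_real x powr (- s - 2)" 1,
      OF assms(2) _ continuous_on_cos_powr(2)[OF assms(2)]]
  have b: "norm (of_real (cos (w * x)) * of_real x powr (- s - 2) :: complex) \<le> 1 * x powr - (Re s + 2)" if "x \<ge> a" for x
    using norm_cos_powr_le[of x w "-s-2"] assms that by simp
  show "(\<lambda>x. of_real (cos (w * x)) * of_real x powr (- s - 2) :: complex) integrable_on {a..}"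
    by (rule *(1)) (use assms b in auto)
  have "1 - (Re s + 2) = - Re s - 1" "Re s + 2 - 1 = Re s + 1" by auto
  thus "norm (integral {a..} (\<lambda>x. of_real (cos (w * x)) * of_real x powr (- s - 2) :: complex))
           \<le> a powr (- Re s - 1) / (Re s + 1)"
    using *(2)[OF _ b] assms by (simp only:) simp
qed

lemma norm_osc_le:
  assumes "Re s > -1"
  shows "norm (osc n s) \<le> 1 / (Re s + 1)"
  using cos_powr_integral_bound(2)[OF assms, of 1 "2 * pi * real n"] by (simp add: osc_def)

lemma osc_recursion:
  assumes s: "Re s > -1" and n: "n > 0"
  shows "osc n s = (s + 2) / (4 * of_real pi ^ 2 * of_nat n ^ 2) * (1 - (s + 3) * osc n (s + 2))"
proof -
  define w where "w = 2 * pi * real n"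
  have w: "w > 0" using n by (simp add: w_def)
  \<comment> \<open>\<open>G\<close> collects the boundary terms of both integrations by parts. Its
    second term makes the sines cancel in the derivative, so that only the integrands of
    \<open>osc n s\<close> and \<open>osc n (s + 2)\<close> remain.\<close>
  define G where "G = (\<lambda>x::real. of_real (sin (w * x) / w) * of_real x powr (-s-2)
    - (s+2) * of_real (cos (w * x) / w^2) * of_real x powr (-s-3) :: complex)"
  define g1 where "g1 = (\<lambda>x::real. of_real (cos (w * x)) * of_real x powr (-s-2) :: complex)"
  define g2 where "g2 = (\<lambda>x::real. of_real (cos (w * x)) * of_real x powr (-(s+2)-2) :: complex)"
  define K where "K = (s+2) * (s+3) / of_real w ^ 2"
  have der: "(G has_vector_derivative (g1 x + K * g2 x)) (at x)" if "x > 0" for x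
  proof -
    have e1: "(of_real x :: complex) powr (- s - 3) = of_real x powr (- s - 2) / of_real x"
      using powr_diff[of "of_real x::complex" "-s-2" 1] that by (simp add: algebra_simps)
    have e2: "(of_real x :: complex) powr (- s - 4) = of_real x powr (- s - 2) / of_real x / of_real x"
      using powr_diff[of "of_real x::complex" "-s-3" 1] that e1 by (simp add: algebra_simps)
    have p: "((\<lambda>x. of_real x powr z :: complex) has_vector_derivative z * of_real x powr (z - 1)) (at x)" for z
      using has_field_derivative_powr[of "of_real x" z] that
      by (intro has_vector_derivative_real_field) (auto simp: complex_nonpos_Reals_iff)
    have c: "((\<lambda>x. of_real (cos (w * x) / w^2) :: complex) has_vector_derivative of_real (- sin (w*x) / w)) (at x)"
      using w by (intro has_vector_derivative_of_real) (auto intro!: derivative_eq_intros simp: field_simps power2_eq_square)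
    have d: "((\<lambda>x. of_real (sin (w * x) / w) :: complex) has_vector_derivative of_real (cos (w*x))) (at x)"
      using w by (intro has_vector_derivative_of_real) (auto intro!: derivative_eq_intros)
    show ?thesis unfolding G_def g1_def g2_def K_def
      by (rule has_vector_derivative_eq_rhs,
          rule has_vector_derivative_diff[OF has_vector_derivative_mult[OF d p]
             has_vector_derivative_mult[OF has_vector_derivative_mult[OF has_vector_derivative_const c] p]])
         (use w that in \<open>simp add: e1 e2 field_simps power2_eq_square\<close>)
  qed
  have ftc: "integral {1..b} g1 + K * integral {1..b} g2 = G b - G 1" if b: "b \<ge> 1" for b
  proof -
    have "((\<lambda>x. g1 x + K * g2 x) has_integral (G b - G 1)) {1..b}"
      using der by (intro fundamental_theorem_of_calculus b)
        (auto intro: has_vector_derivative_at_within)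
    moreover have "((\<lambda>x. g1 x + K * g2 x) has_integral (integral {1..b} g1 + K * integral {1..b} g2)) {1..b}"
      by (intro has_integral_add has_integral_mult_right integrable_integral integrable_continuous_real)
         (auto simp: g1_def g2_def intro!: continuous_on_cos_powr)
    ultimately show ?thesis using has_integral_unique by blast
  qed
  have l1: "((\<lambda>b. integral {1..b} g1) \<longlongrightarrow> osc n s) at_top"
    unfolding osc_def g1_def w_def
    by (rule integral_tail_powr_tendsto[of _ "Re s + 2" _ 1])
       (use s norm_cos_powr_le[of _ _ "-s-2"] in \<open>auto intro!: continuous_on_cos_powr\<close>)
  have l2: "((\<lambda>b. integral {1..b} g2) \<longlongrightarrow> osc n (s+2)) at_top"
    unfolding osc_def g2_def w_def
    by (rule integral_tail_powr_tendsto[of _ "Re (s+2) + 2" _ 1])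
       (use s norm_cos_powr_le[of _ _ "-(s+2)-2"] in \<open>auto intro!: continuous_on_cos_powr\<close>)
  have lG: "(G \<longlongrightarrow> 0) at_top"
  proof (rule Lim_null_comparison)
    have "((\<lambda>b. 1 / w * b powr (-Re s - 2) + norm (s+2) / w^2 * b powr (-Re s - 3)) \<longlongrightarrow> 1/w * 0 + norm (s+2) / w^2 * 0) at_top"
      using s by (intro tendsto_intros tendsto_neg_powr filterlim_ident) auto
    thus "((\<lambda>b. 1 / w * b powr (-Re s - 2) + norm (s+2) / w^2 * b powr (-Re s - 3)) \<longlongrightarrow> 0) at_top" by simp
    show "\<forall>\<^sub>F b in at_top. norm (G b) \<le> 1 / w * b powr (-Re s - 2) + norm (s+2) / w^2 * b powr (-Re s - 3)"
      using eventually_gt_at_top[of 0]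
    proof eventually_elim
      case (elim b)
      have "norm (G b) \<le> \<bar>sin (w*b)\<bar> / w * b powr (-Re s - 2) + norm (s+2) * (\<bar>cos (w*b)\<bar> / w^2) * b powr (-Re s - 3)"
        unfolding G_def using w elim
        by (intro order_trans[OF norm_triangle_ineq4] add_mono) (auto simp: norm_mult norm_divide norm_power norm_of_real_powr)
      also have "\<dots> \<le> 1 / w * b powr (-Re s - 2) + norm (s+2) * (1 / w^2) * b powr (-Re s - 3)"
        using w by (intro add_mono mult_right_mono mult_left_mono divide_right_mono) auto
      finally show ?case by simp
    qed
  qed
  have "osc n s + K * osc n (s+2) = 0 - G 1"
  proof (rule tendsto_unique)
    show "((\<lambda>b. integral {1..b} g1 + K * integral {1..b} g2) \<longlongrightarrow> osc n s + K * osc n (s+2)) at_top"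
      by (intro tendsto_intros l1 l2)
    have "((\<lambda>b. G b - G 1) \<longlongrightarrow> 0 - G 1) at_top" by (intro tendsto_intros lG)
    thus "((\<lambda>b. integral {1..b} g1 + K * integral {1..b} g2) \<longlongrightarrow> 0 - G 1) at_top"
      by (rule Lim_transform_eventually)
         (rule eventually_mono[OF eventually_ge_at_top[of "1::real"]], simp add: ftc)
  qed simp
  \<comment> \<open>\<open>w\<close> is an integer multiple of 2 pi, so the sine term vanishes at 1
    and only the term with 1 / w^2 survives: this is the gain of n^(-2).\<close>
  moreover have "G 1 = - ((s+2) / of_real w ^ 2)"
  proof -
    have "sin w = 0" "cos w = 1"
      using sin_2npi[of n] cos_2npi[of n] by (simp_all add: w_def mult_ac del: sin_2npi cos_2npi)
    thus ?thesis by (simp add: G_def)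
  qed
  ultimately have "osc n s = (s+2) / of_real w ^ 2 - K * osc n (s+2)"
    by (simp add: algebra_simps)
  also have "\<dots> = (s+2) / of_real w ^ 2 * (1 - (s+3) * osc n (s+2))"
    unfolding K_def by (simp add: right_diff_distrib)
  also have "(of_real w ^ 2 :: complex) = 4 * of_real pi ^ 2 * of_nat n ^ 2"
    by (simp add: w_def power_mult_distrib)
  finally show ?thesis .
qed

text \<open>Differentiation under the integral sign is done on the compact intervals from 1 to 1 +
  m; the tail bound makes these truncations converge locally uniformly.\<close>

lemma osc_holomorphic: "osc n holomorphic_on {s. Re s > -1}"
proof (rule holomorphic_uniform_sequence)
  define g where "g = (\<lambda>s x. of_real (cos (2 * pi * real n * x)) * of_real x powr (- s - 2) :: complex)"
  show "open {s. Re s > -1}" by (rule open_halfspace_Re_gt)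
  show "(\<lambda>s. integral (cbox 1 (1 + real m)) (g s)) holomorphic_on {s. Re s > -1}" for m
  proof (rule leibniz_rule_holomorphic)
    show "((\<lambda>s. g s x) has_field_derivative - (of_real (cos (2 * pi * real n * x)) * of_real x powr (- s - 2) * of_real (ln x))) (at s within {s. Re s > -1})"
      if "s \<in> {s. Re s > -1}" "x \<in> cbox 1 (1 + real m)" for s x
    proof -
      have "((\<lambda>s. (of_real x :: complex) powr (- s - 2)) has_field_derivative
          (Ln (of_real x) * of_real x powr (- s - 2)) * (- 1)) (at s within {s. Re s > -1})"
        by (rule DERIV_chain'[OF _ has_field_derivative_powr_right])
           (use that in \<open>auto intro!: derivative_eq_intros\<close>)
      from DERIV_cmult[OF this, of "of_real (cos (2 * pi * real n * x))"]
      show ?thesis using that by (simp add: g_def Ln_of_real mult_ac)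
    qed
    show "g s integrable_on cbox 1 (1 + real m)" for s
      unfolding g_def by (intro integrable_continuous continuous_on_cos_powr[of 1, simplified cbox_interval[symmetric]]) auto
    show "convex {s. Re s > -1}" by (rule convex_halfspace_Re_gt)
    show "continuous_on ({s. Re s > -1} \<times> cbox 1 (1 + real m)) (\<lambda>(s, x). - (of_real (cos (2 * pi * real n * x)) * of_real x powr (- s - 2) * of_real (ln x)))"
      by (auto intro!: continuous_intros simp: case_prod_unfold)
  qed
  fix s assume "s \<in> {s. Re s > -1}"
  hence s: "Re s > -1" by simp
  \<comment> \<open>Half the distance from \<open>s\<close> to the line Re = -1. On the closed disc
    the tail beyond 1 + m is then at most \<open>(1 + real m) powr (-d) / d\<close>, whatever the
    point.\<close>
  define d where "d = (Re s + 1) / 2"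
  have d: "d > 0" using s by (simp add: d_def)
  have re: "Re z \<ge> -1 + d" if "z \<in> cball s d" for z
  proof -
    have "\<bar>Re (s - z)\<bar> \<le> d" using that abs_Re_le_cmod[of "s - z"] by (simp add: dist_norm)
    thus ?thesis by (simp add: d_def field_simps) (smt (verit))
  qed
  have "uniform_limit (cball s d) (\<lambda>m s. integral (cbox 1 (1 + real m)) (g s)) (osc n) sequentially"
  proof (rule uniform_limitI)
    fix e :: real assume e: "e > 0"
    have "(\<lambda>m. (1 + real m) powr (-d) / d) \<longlonglongrightarrow> 0 / d"
      using d by (intro tendsto_intros tendsto_neg_powr
         filterlim_tendsto_add_at_top[OF tendsto_const] filterlim_real_sequentially) auto
    hence "\<forall>\<^sub>F m in sequentially. (1 + real m) powr (-d) / d < e"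
      using e by (intro order_tendstoD) auto
    thus "\<forall>\<^sub>F m in sequentially. \<forall>z\<in>cball s d. dist (integral (cbox 1 (1 + real m)) (g z)) (osc n z) < e"
    proof (eventually_elim, intro ballI)
      fix m z assume m: "(1 + real m) powr (-d) / d < e" and z: "z \<in> cball s d"
      note r = re[OF z]
      have "osc n z = integral {1..1+real m} (g z) + integral {1+real m..} (g z)"
        unfolding osc_def g_def using r d
        by (intro integral_atLeast_split cos_powr_integral_bound continuous_on_cos_powr) auto
      hence "dist (integral (cbox 1 (1 + real m)) (g z)) (osc n z) = norm (integral {1+real m..} (g z))"
        by (simp add: dist_norm)
      also have "\<dots> \<le> (1 + real m) powr (- Re z - 1) / (Re z + 1)"
        unfolding g_def using r d by (intro cos_powr_integral_bound) auto
      also have "\<dots> \<le> (1 + real m) powr (-d) / d"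
        using r d by (intro frac_le powr_mono) auto
      finally show "dist (integral (cbox 1 (1 + real m)) (g z)) (osc n z) < e" using m by simp
    qed
  qed
  moreover have "cball s d \<subseteq> {s. Re s > -1}" using re d by force
  ultimately show "\<exists>d>0. cball s d \<subseteq> {s. Re s > -1} \<and> uniform_limit (cball s d) (\<lambda>m s. integral (cbox 1 (1 + real m)) (g s)) (osc n) sequentially"
    using d by blast
qed

section \<open>The Fourier series of the second Bernoulli polynomial\<close>

text \<open>With u = pi t, 1 - e^(2iu) = 2 sin(u) e^(i(u - pi/2)). The first factor is positive, and
  the angle lies in the principal range, so no multiple of 2 pi enters.\<close>

lemma Im_Ln_one_minus_cis:
  assumes t: "0 < t" "t < 1"
  shows "Im (Ln (1 - cis (2 * pi * t))) = pi * (t - 1 / 2)"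
proof -
  have sp: "sin (pi * t) > 0" using t by (intro sin_gt_zero) auto
  have "1 - cis (2 * pi * t) = of_real (2 * sin (pi * t)) * cis (pi * (t - 1/2))"
  proof -
    define u where "u = pi * t"
    have *: "2 * pi * t = 2 * u" "pi * (t - 1/2) = u - pi / 2"
      by (simp_all add: u_def algebra_simps)
    show ?thesis unfolding * u_def[symmetric]
      using cos_double_sin[of u] sin_double[of u]
      by (simp add: complex_eq_iff cos_diff sin_diff power2_eq_square)
  qed
  hence "Ln (1 - cis (2 * pi * t)) = of_real (ln (2 * sin (pi * t))) + Ln (cis (pi * (t - 1/2)))"
    using sp Ln_times_of_real[of "2 * sin (pi * t)" "cis (pi * (t - 1/2))"] Ln_of_real[of "2 * sin (pi * t)"] by simp
  moreover have "pi * (t - 1/2) \<in> {-pi<..pi}"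
    using mult_strict_left_mono[of "-1" "t - 1/2" pi] mult_left_mono[of "t - 1/2" 1 pi] t by simp
  hence "Ln (cis (pi * (t - 1/2))) = (pi * (t - 1/2)) * \<i>" by (rule Ln_cis)
  ultimately show ?thesis by simp
qed

lemma abs_Im_Ln_le_pi: "z \<noteq> 0 \<Longrightarrow> \<bar>Im (Ln z)\<bar> \<le> pi"
  using Im_Ln_le_pi[of z] mpi_less_Im_Ln[of z] by linarith

text \<open>Abel means of the sawtooth series: inside the unit disc its conditional convergence is
  replaced by that of the power series of the logarithm.\<close>

lemma sin_power_sums_Im_Ln:
  assumes r: "0 \<le> r" "r < 1"
  shows "(\<lambda>n. r ^ Suc n * sin (real (Suc n) * t) / real (Suc n)) sums (- Im (Ln (1 - of_real r * cis t)))"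
proof -
  have "norm (- (of_real r * cis t)) < 1" using r by (simp add: norm_mult)
  from Ln_series'[OF this]
  have "(\<lambda>n. - ((of_real r * cis t) ^ n) / of_nat n) sums ln (1 - of_real r * cis t)" by simp
  from sums_Im[OF this]
  have "(\<lambda>n. - (r ^ n * sin (real n * t) / real n)) sums Im (Ln (1 - of_real r * cis t))"
    by (simp add: power_mult_distrib Complex.DeMoivre flip: of_real_power)
  from sums_minus[OF this]
  have "(\<lambda>n. r ^ n * sin (real n * t) / real n) sums (- Im (Ln (1 - of_real r * cis t)))" by simp
  thus ?thesis
    using sums_Suc_iff[of "\<lambda>n. r ^ n * sin (real n * t) / real n" "- Im (Ln (1 - of_real r * cis t))"]
    by (simp del: of_nat_Suc power_Suc)
qed

text \<open>For r < 1 the partial sums are dominated by a geometric series, which justifies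
  integration term by term. Integrating from 0 produces 1 - cos.\<close>

lemma cos_power_sums_integral:
  assumes r: "0 \<le> r" "r < 1" and x: "0 \<le> x"
  shows "(\<lambda>n. r ^ Suc n * ((1 - cos (2 * pi * real (Suc n) * x)) / (2 * pi * real (Suc n) ^ 2))) sums
    integral {0..x} (\<lambda>t. - Im (Ln (1 - of_real r * cis (2 * pi * t))))" (is "?c sums _")
    and "(\<lambda>t. - Im (Ln (1 - of_real r * cis (2 * pi * t)))) integrable_on {0..x}"
proof -
  define f where "f n t = r ^ Suc n * sin (real (Suc n) * (2 * pi * t)) / real (Suc n)" for n t
  have hi: "(f n has_integral ?c n) {0..x}" for n
  proof -
    have "(f n has_integral (- (r ^ Suc n * cos (real (Suc n) * (2 * pi * x)) / (2 * pi * real (Suc n) ^ 2))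
         - (- (r ^ Suc n * cos (real (Suc n) * (2 * pi * 0)) / (2 * pi * real (Suc n) ^ 2))))) {0..x}"
      using x unfolding f_def
      by (intro fundamental_theorem_of_calculus)
         (auto simp flip: has_real_derivative_iff_has_vector_derivative simp del: of_nat_Suc
            intro!: derivative_eq_intros simp: power2_eq_square)
    also have "- (r ^ Suc n * cos (real (Suc n) * (2 * pi * x)) / (2 * pi * real (Suc n) ^ 2))
         - (- (r ^ Suc n * cos (real (Suc n) * (2 * pi * 0)) / (2 * pi * real (Suc n) ^ 2))) = ?c n"
      by (simp add: field_simps del: of_nat_Suc)
    finally show ?thesis .
  qed
  have hN: "((\<lambda>t. \<Sum>n<N. f n t) has_integral (\<Sum>n<N. ?c n)) {0..x}" for N
    by (rule has_integral_sum) (use hi in auto)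
  have b: "norm (\<Sum>n<N. f n t) \<le> 1 / (1 - r)" for N t
  proof -
    have "norm (\<Sum>n<N. f n t) \<le> (\<Sum>n<N. r ^ n)"
    proof (rule sum_norm_le)
      fix n
      have "norm (f n t) = r ^ Suc n * (\<bar>sin (real (Suc n) * (2 * pi * t))\<bar> / real (Suc n))"
        using r by (simp add: f_def abs_mult del: of_nat_Suc)
      also have "\<dots> \<le> r ^ n * 1"
        using r abs_sin_le_one[of "real (Suc n) * (2 * pi * t)"]
        by (intro mult_mono power_decreasing) (auto simp: divide_simps simp del: of_nat_Suc abs_sin_le_one)
      finally show "norm (f n t) \<le> r ^ n" by simp
    qed
    also have "\<dots> \<le> 1 / (1 - r)"
      using r by (simp add: sum_gp_strict divide_right_mono)
    finally show ?thesis .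
  qed
  have lim: "(\<lambda>N. \<Sum>n<N. f n t) \<longlonglongrightarrow> - Im (Ln (1 - of_real r * cis (2 * pi * t)))" for t
    using sin_power_sums_Im_Ln[OF r, of "2 * pi * t"] unfolding sums_def f_def .
  note dc = dominated_convergence[of "\<lambda>N t. \<Sum>n<N. f n t" "{0..x}" "\<lambda>_. 1 / (1 - r)", OF _ _ b lim]
  show "(\<lambda>t. - Im (Ln (1 - of_real r * cis (2 * pi * t)))) integrable_on {0..x}"
    by (rule dc(1)) (use hN in blast)+
  have "(\<lambda>N. integral {0..x} (\<lambda>t. \<Sum>n<N. f n t)) \<longlonglongrightarrow> integral {0..x} (\<lambda>t. - Im (Ln (1 - of_real r * cis (2 * pi * t))))"
    by (rule dc(2)) (use hN in blast)+
  thus "?c sums integral {0..x} (\<lambda>t. - Im (Ln (1 - of_real r * cis (2 * pi * t))))"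
    unfolding sums_def using integral_unique[OF hN] by simp
qed

lemma summable_inverse_squares_Suc: "summable (\<lambda>n. 1 / real (Suc n) ^ 2)"
  using inverse_squares_sums by (auto simp: sums_iff add_ac)

text \<open>Let r tend to 1 in \<open>cos_power_sums_integral\<close>. After integration both sides
  have easy majorants: 1/n^2 for the series (Tannery), and the constant pi for the integrand, which
  is an imaginary part of a principal logarithm.\<close>

lemma cos_sums_bernoulli2:
  assumes x: "0 \<le> x" "x \<le> 1"
  shows "(\<lambda>n. cos (2 * pi * real (Suc n) * x) / real (Suc n) ^ 2) sums (pi\<^sup>2 * (x\<^sup>2 - x + 1 / 6))"
proof -
  define c where "c n = (1 - cos (2 * pi * real (Suc n) * x)) / (2 * pi * real (Suc n) ^ 2)" for n
  define r where "r m = real m / real (Suc m)" for m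
  have r: "0 \<le> r m" "r m < 1" for m by (auto simp: r_def)
  have rlim: "r \<longlonglongrightarrow> 1" unfolding r_def by (rule LIMSEQ_n_over_Suc_n)
  define L where "L r t = - Im (Ln (1 - of_real r * cis (2 * pi * t)))" for r t
  \<comment> \<open>The pointwise limit of the integrands. At t = 0 and t = 1 the logarithm is taken
    of the positive real 1 - r, so the limit there is 0 and not the value of the linear formula;
    these two points are discarded later as a null set.\<close>
  define g where "g t = (if t = 0 \<or> t = 1 then 0 else pi * (1/2 - t))" for t :: real
  have cb: "norm (c n) \<le> 1 / real (Suc n) ^ 2" for n
  proof -
    have "norm (c n) = \<bar>1 - cos (2 * pi * real (Suc n) * x)\<bar> / (2 * pi) * (1 / real (Suc n) ^ 2)"
      by (simp add: c_def abs_mult del: of_nat_Suc)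
    also have "\<dots> \<le> 1 * (1 / real (Suc n) ^ 2)"
    proof (rule mult_right_mono)
      have "\<bar>1 - cos (2 * pi * real (Suc n) * x)\<bar> \<le> 2"
        using cos_ge_minus_one[of "2 * pi * real (Suc n) * x"] cos_le_one[of "2 * pi * real (Suc n) * x"] by linarith
      hence "\<bar>1 - cos (2 * pi * real (Suc n) * x)\<bar> \<le> 2 * pi" using pi_ge_two by linarith
      thus "\<bar>1 - cos (2 * pi * real (Suc n) * x)\<bar> / (2 * pi) \<le> 1" by (simp del: of_nat_Suc)
    qed auto
    finally show ?thesis by simp
  qed
  have summ: "summable c"
    by (rule summable_comparison_test'[OF summable_inverse_squares_Suc]) (use cb in auto)
  have lhs: "(\<lambda>m. \<Sum>n. r m ^ Suc n * c n) \<longlonglongrightarrow> (\<Sum>n. c n)"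
  proof (rule tannerys_theorem[where a = "\<lambda>n m. r m ^ Suc n * c n", THEN conjunct2, THEN conjunct2, OF _ _ summable_inverse_squares_Suc])
    show "((\<lambda>m. r m ^ Suc n * c n) \<longlongrightarrow> c n) sequentially" for n
      using tendsto_mult[OF tendsto_power[OF rlim, of "Suc n"] tendsto_const[of "c n"]] by simp
    show "\<forall>\<^sub>F (n, m) in at_top \<times>\<^sub>F sequentially. norm (r m ^ Suc n * c n) \<le> 1 / real (Suc n) ^ 2"
    proof (rule always_eventually, safe)
      fix n m
      have "norm (r m ^ Suc n * c n) = r m ^ Suc n * norm (c n)" using r[of m] by (simp add: norm_mult abs_mult)
      also have "\<dots> \<le> 1 * (1 / real (Suc n) ^ 2)"
        using r[of m] cb[of n] by (intro mult_mono power_le_one) auto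
      finally show "norm (r m ^ Suc n * c n) \<le> 1 / real (Suc n) ^ 2" by simp
    qed
  qed auto
  have S: "(\<Sum>n. r m ^ Suc n * c n) = integral {0..x} (L (r m))" for m
    using sums_unique[OF cos_power_sums_integral(1)[OF r x(1)]] unfolding c_def L_def by simp
  have lim: "(\<lambda>m. L (r m) t) \<longlonglongrightarrow> g t" if t: "t \<in> {0..x}" for t
  proof (cases "0 < t \<and> t < 1")
    case True
    have "cos (2 * pi * t) < 1"
    proof -
      have "sin (pi * t) > 0" using True by (intro sin_gt_zero) auto
      thus ?thesis using cos_double_sin[of "pi * t"] by (simp add: mult.assoc)
    qed
    hence "Re (1 - of_real 1 * cis (2 * pi * t)) > 0" by simp
    hence "1 - of_real 1 * cis (2 * pi * t) \<notin> \<real>\<^sub>\<le>\<^sub>0" by (force simp: complex_nonpos_Reals_iff)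
    hence "(\<lambda>m. L (r m) t) \<longlonglongrightarrow> L 1 t" unfolding L_def by (intro tendsto_intros rlim)
    also have "L 1 t = g t"
      using Im_Ln_one_minus_cis[of t] True by (simp add: L_def g_def algebra_simps)
    finally show ?thesis .
  next
    case False
    hence "t = 0 \<or> t = 1" using t x by auto
    hence c1: "cis (2 * pi * t) = 1" by auto
    have "Ln (1 - of_real (r m)) = of_real (ln (1 - r m))" for m
      using r[of m] Ln_of_real[of "1 - r m"] by simp
    hence "L (r m) t = 0" for m using c1 unfolding L_def by simp
    thus ?thesis using \<open>t = 0 \<or> t = 1\<close> by (auto simp: g_def)
  qed
  have "(\<lambda>m. integral {0..x} (L (r m))) \<longlonglongrightarrow> integral {0..x} g"
  proof (rule dominated_convergence(2)[where h = "\<lambda>_. pi"])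
    show "L (r m) integrable_on {0..x}" for m
      using cos_power_sums_integral(2)[OF r x(1), of m] unfolding L_def .
    show "norm (L (r m) t) \<le> pi" for m t
    proof -
      have "norm (of_real (r m) * cis (2 * pi * t)) < norm (1::complex)"
        using r[of m] by (simp add: norm_mult)
      hence "1 - of_real (r m) * cis (2 * pi * t) \<noteq> 0" by fastforce
      thus ?thesis unfolding L_def using abs_Im_Ln_le_pi by simp
    qed
  qed (use lim in auto)
  hence "(\<Sum>n. c n) = integral {0..x} g"
    using lhs LIMSEQ_unique unfolding S by blast
  also have "\<dots> = integral {0..x} (\<lambda>t. pi * (1/2 - t))"
  proof (rule integral_spike[of "{0, 1}"])
    fix t assume "t \<in> {0..x} - {0, 1}"
    hence "0 < t" "t < 1" using x by auto
    thus "pi * (1/2 - t) = g t" by (simp add: g_def)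
  qed auto
  also have "\<dots> = pi * (x - x\<^sup>2) / 2"
  proof (rule integral_unique)
    have "((\<lambda>t. pi * (1/2 - t)) has_integral (pi * (x - x\<^sup>2) / 2 - pi * (0 - 0\<^sup>2) / 2)) {0..x}"
      using x by (intro fundamental_theorem_of_calculus)
         (auto simp flip: has_real_derivative_iff_has_vector_derivative
            intro!: derivative_eq_intros simp: field_simps)
    thus "((\<lambda>t. pi * (1/2 - t)) has_integral (pi * (x - x\<^sup>2) / 2)) {0..x}" by simp
  qed
  finally have "c sums (pi * (x - x\<^sup>2) / 2)" using summ by (simp add: sums_iff)
  \<comment> \<open>Since cos = 1 - (1 - cos), the sum pi^2/6 of the inverse squares enters; it
    supplies the constant 1/6 of the Bernoulli polynomial.\<close>
  from sums_diff[OF inverse_squares_sums sums_mult[OF this, of "2 * pi"]]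
  have "(\<lambda>n. 1 / (real n + 1)\<^sup>2 - 2 * pi * c n) sums (pi\<^sup>2 / 6 - 2 * pi * (pi * (x - x\<^sup>2) / 2))" 
    by (simp add: add_ac)
  also have "(\<lambda>n. 1 / (real n + 1)\<^sup>2 - 2 * pi * c n) = (\<lambda>n. cos (2 * pi * real (Suc n) * x) / real (Suc n) ^ 2)"
  proof
    fix n
    have "2 * pi * c n = (1 - cos (2 * pi * real (Suc n) * x)) / real (Suc n) ^ 2"
      by (simp add: c_def del: of_nat_Suc)
    also have "\<dots> = 1 / real (Suc n) ^ 2 - cos (2 * pi * real (Suc n) * x) / real (Suc n) ^ 2"
      by (rule diff_divide_distrib)
    finally have "1 / real (Suc n) ^ 2 - 2 * pi * c n = cos (2 * pi * real (Suc n) * x) / real (Suc n) ^ 2"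
      by simp
    thus "1 / (real n + 1)\<^sup>2 - 2 * pi * c n = cos (2 * pi * real (Suc n) * x) / real (Suc n) ^ 2"
      using of_nat_Suc[of n, where 'a = real] by (metis add.commute)
  qed
  also have "pi\<^sup>2 / 6 - 2 * pi * (pi * (x - x\<^sup>2) / 2) = pi\<^sup>2 * (x\<^sup>2 - x + 1 / 6)"
  proof -
    have *: "2 * pi * (pi * (x - x\<^sup>2) / 2) = pi\<^sup>2 * (x - x\<^sup>2)" by (simp add: power2_eq_square)
    show ?thesis unfolding * by (simp add: algebra_simps)
  qed
  finally show ?thesis .
qed

section \<open>The Hurwitz zeta function at integers\<close>

text \<open>Substitute x = a y. As \<open>a\<close> is a natural number, the new frequency is again
  an integer, and up to a power of \<open>a\<close> the integral depends only on the product of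
  \<open>n\<close> and \<open>a\<close>. This is what later allows regrouping by the
  product.\<close>

lemma cos_powr_integral_scale:
  assumes s: "Re s > -1" and a: "a > 0"
  shows "integral {real a..} (\<lambda>x. of_real (cos (2 * pi * real n * x)) * of_real x powr (- s - 2) :: complex)
    = of_nat a powr (- s - 1) * osc (n * a) s"
proof -
  define f where "f = (\<lambda>x. of_real (cos (2 * pi * real n * x)) * of_real x powr (- s - 2) :: complex)"
  define g where "g = (\<lambda>x. of_real (cos (2 * pi * real (n * a) * x)) * of_real x powr (- s - 2) :: complex)"
  have A: "real a > 0" using a by simp
  have eq: "integral {real a..real a * b} f = of_nat a powr (- s - 1) * integral {1..b} g" if b: "b \<ge> 1" for b
  proof -
    have c: "continuous_on {real a..real a * b} f"
      unfolding f_def using A by (intro continuous_on_cos_powr)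
    have "(f has_integral integral {real a..real a * b} f) (cbox (real a) (real a * b))"
      using integrable_integral[OF integrable_continuous_real[OF c]] by simp
    from has_integral_affinity'[OF this A, of 0]
    have 1: "((\<lambda>x. f (real a * x)) has_integral integral {real a..real a * b} f / of_nat a) {1..b}"
      using a b by (simp add: scaleR_conv_of_real field_simps)
    have 2: "f (real a * x) = of_nat a powr (- s - 2) * g x" if "x \<in> {1..b}" for x
      using that a powr_times_real[of "of_nat a" "of_real x" "-s-2"]
      by (simp add: f_def g_def mult_ac)
    have 3: "((\<lambda>x. of_nat a powr (- s - 2) * g x) has_integral of_nat a powr (- s - 2) * integral {1..b} g) {1..b}"
      unfolding g_def
      by (intro has_integral_mult_right integrable_integral integrable_continuous_real continuous_on_cos_powr) auto
    have "integral {real a..real a * b} f / of_nat a = of_nat a powr (- s - 2) * integral {1..b} g"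
      by (rule has_integral_unique[OF 1 has_integral_eq[OF 2[symmetric] 3]])
    moreover have "(of_nat a :: complex) powr (- s - 1) = of_nat a powr (- s - 2) * of_nat a"
    proof -
      have e: "- s - 1 = (- s - 2) + 1" by simp
      show ?thesis unfolding e powr_add using a by simp
    qed
    ultimately show ?thesis using a by (simp add: field_simps)
  qed
  have l1: "((\<lambda>b. integral {real a..b} f) \<longlongrightarrow> integral {real a..} f) at_top"
    unfolding f_def
    by (rule integral_tail_powr_tendsto[of _ "Re s + 2" _ 1])
       (use A s norm_cos_powr_le[of _ _ "-s-2"] in \<open>auto intro!: continuous_on_cos_powr\<close>)
  have l2: "((\<lambda>b. integral {1..b} g) \<longlongrightarrow> osc (n * a) s) at_top"
    unfolding osc_def g_def
    by (rule integral_tail_powr_tendsto[of _ "Re s + 2" _ 1])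
       (use s norm_cos_powr_le[of _ _ "-s-2"] in \<open>auto intro!: continuous_on_cos_powr\<close>)
  have "filterlim (\<lambda>b. real a * b) at_top at_top"
    using A by (intro filterlim_tendsto_pos_mult_at_top[OF tendsto_const]) (auto intro: filterlim_ident)
  from filterlim_compose[OF l1 this]
  have "((\<lambda>b. integral {real a..real a * b} f) \<longlongrightarrow> integral {real a..} f) at_top" .
  moreover have "((\<lambda>b. integral {real a..real a * b} f) \<longlongrightarrow> of_nat a powr (- s - 1) * osc (n * a) s) at_top"
    by (rule Lim_transform_eventually[OF tendsto_mult[OF tendsto_const l2]])
       (rule eventually_mono[OF eventually_ge_at_top[of "1::real"]], simp add: eq)
  ultimately show ?thesis unfolding f_def by (intro tendsto_unique[of at_top]) auto
qed

text \<open>The encoding as a series, not through fractional parts, gives continuity across the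
  integers and bounded partial sums directly from the majorant 1/n^2.\<close>

definition cos_series :: "real \<Rightarrow> real" where
  "cos_series x = (\<Sum>n. cos (2 * pi * real (Suc n) * x) / real (Suc n) ^ 2)"

lemma norm_cos_series_term_le: "norm (cos (2 * pi * real (Suc n) * x) / real (Suc n) ^ 2) \<le> 1 / real (Suc n) ^ 2"
  by (simp add: divide_right_mono del: of_nat_Suc)

lemma cos_series_sums: "(\<lambda>n. cos (2 * pi * real (Suc n) * x) / real (Suc n) ^ 2) sums cos_series x"
  unfolding cos_series_def
  by (rule summable_sums, rule summable_comparison_test'[OF summable_inverse_squares_Suc norm_cos_series_term_le])

lemma cos_series_eq:
  assumes "real m \<le> x" "x \<le> real m + 1"
  shows "cos_series x = pi\<^sup>2 * ((x - real m)\<^sup>2 - (x - real m) + 1 / 6)"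
proof -
  have "cos (2 * pi * real (Suc n) * x) = cos (2 * pi * real (Suc n) * (x - real m))" for n
  proof -
    have "2 * pi * real (Suc n) * x = 2 * pi * real (Suc n) * (x - real m) + 2 * real (Suc n * m) * pi"
      by (simp add: algebra_simps)
    thus ?thesis by (simp only: cos_add cos_2npi sin_2npi mult_1_right mult_zero_right diff_0_right)
  qed
  thus ?thesis
    using cos_series_sums[of x] cos_sums_bernoulli2[of "x - real m"] assms
    by (simp add: sums_unique2 del: of_nat_Suc)
qed

lemma continuous_on_cos_series: "continuous_on S cos_series"
proof (rule uniform_limit_theorem)
  show "uniform_limit S (\<lambda>N x. \<Sum>n<N. cos (2 * pi * real (Suc n) * x) / real (Suc n) ^ 2) cos_series sequentially"
    unfolding cos_series_def
    by (rule Weierstrass_m_test[OF norm_cos_series_term_le summable_inverse_squares_Suc])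
  show "\<forall>\<^sub>F N in sequentially. continuous_on S (\<lambda>x. \<Sum>n<N. cos (2 * pi * real (Suc n) * x) / real (Suc n) ^ 2)"
    by (intro always_eventually allI continuous_intros) auto
qed auto

lemma abs_sum_cos_series_le: "\<bar>\<Sum>n<N. cos (2 * pi * real (Suc n) * x) / real (Suc n) ^ 2\<bar> \<le> pi\<^sup>2 / 6"
proof -
  have "\<bar>\<Sum>n<N. cos (2 * pi * real (Suc n) * x) / real (Suc n) ^ 2\<bar> \<le> (\<Sum>n<N. 1 / real (Suc n) ^ 2)"
    using sum_norm_le[of "{..<N}", OF norm_cos_series_term_le] by simp
  also have "\<dots> \<le> (\<Sum>n. 1 / real (Suc n) ^ 2)"
    by (rule sum_le_suminf[OF summable_inverse_squares_Suc]) auto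
  also have "\<dots> = pi\<^sup>2 / 6" using inverse_squares_sums by (simp add: sums_iff add_ac)
  finally show ?thesis .
qed

lemma abs_cos_series_le: "\<bar>cos_series x\<bar> \<le> pi\<^sup>2 / 6"
proof (rule LIMSEQ_le_const2)
  show "(\<lambda>N. \<bar>\<Sum>n<N. cos (2 * pi * real (Suc n) * x) / real (Suc n) ^ 2\<bar>) \<longlonglongrightarrow> \<bar>cos_series x\<bar>"
    using cos_series_sums[of x] unfolding sums_def by (rule tendsto_rabs)
qed (use abs_sum_cos_series_le in auto)

text \<open>The partial sums of \<open>cos_series\<close> are bounded by pi^2/6, so a multiple of
  \<open>x powr (- Re s - 2)\<close> dominates and the sum may leave the integral.\<close>

lemma cos_series_powr_sums:
  assumes s: "Re s > -1" and a: "a > 0"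
  shows "(\<lambda>n. osc (Suc n * a) s / of_nat (Suc n) ^ 2 * of_nat a powr (- s - 1)) sums
    integral {real a..} (\<lambda>x. of_real (cos_series x) * of_real x powr (- s - 2))"
proof -
  have A: "real a > 0" using a by simp
  define c where "c n x = of_real (cos (2 * pi * real (Suc n) * x) / real (Suc n) ^ 2) * of_real x powr (- s - 2)" for n and x :: real
  have hi: "(c n has_integral (osc (Suc n * a) s / of_nat (Suc n) ^ 2 * of_nat a powr (- s - 1))) {real a..}" for n
  proof -
    have "((\<lambda>x. 1 / of_nat (Suc n) ^ 2 * (of_real (cos (2 * pi * real (Suc n) * x)) * of_real x powr (- s - 2) :: complex))
       has_integral 1 / of_nat (Suc n) ^ 2 * (of_nat a powr (- s - 1) * osc (Suc n * a) s)) {real a..}"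
      unfolding cos_powr_integral_scale[OF s a, symmetric]
      by (intro has_integral_mult_right integrable_integral cos_powr_integral_bound s A)
    moreover have "c n = (\<lambda>x. 1 / of_nat (Suc n) ^ 2 * (of_real (cos (2 * pi * real (Suc n) * x)) * of_real x powr (- s - 2)))"
      by (rule ext) (simp add: c_def del: of_nat_Suc)
    ultimately show ?thesis by (simp add: mult.commute del: of_nat_Suc)
  qed
  have hN: "((\<lambda>x. \<Sum>n<N. c n x) has_integral (\<Sum>n<N. osc (Suc n * a) s / of_nat (Suc n) ^ 2 * of_nat a powr (- s - 1))) {real a..}" for N
    by (rule has_integral_sum) (use hi in auto)
  have sc: "(\<Sum>n<N. c n x) = of_real (\<Sum>n<N. cos (2 * pi * real (Suc n) * x) / real (Suc n) ^ 2) * of_real x powr (- s - 2)" for N x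
    by (simp only: c_def of_real_sum sum_distrib_right)
  have "(\<lambda>N. integral {real a..} (\<lambda>x. \<Sum>n<N. c n x)) \<longlonglongrightarrow>
     integral {real a..} (\<lambda>x. of_real (cos_series x) * of_real x powr (- s - 2))"
  proof (rule dominated_convergence(2)[where h = "\<lambda>x. pi\<^sup>2 / 6 * x powr (- Re s - 2)"])
    show "(\<lambda>x. \<Sum>n<N. c n x) integrable_on {real a..}" for N using hN by blast
    show "(\<lambda>x. pi\<^sup>2 / 6 * x powr (- Re s - 2)) integrable_on {real a..}"
      using has_integral_mult_right[OF has_integral_powr_to_inf[of "- Re s - 2" "real a"], of "pi\<^sup>2 / 6"] s A
      by (auto simp: integrable_on_def)
    show "norm (\<Sum>n<N. c n x) \<le> pi\<^sup>2 / 6 * x powr (- Re s - 2)" if "x \<in> {real a..}" for N x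
    proof -
      have "x > 0" using that A by auto
      thus ?thesis unfolding sc norm_mult norm_of_real
        using abs_sum_cos_series_le[of x N] by (simp add: norm_of_real_powr mult_right_mono del: of_nat_Suc)
    qed
    show "(\<lambda>N. \<Sum>n<N. c n x) \<longlonglongrightarrow> of_real (cos_series x) * of_real x powr (- s - 2)" for x
      unfolding sc using cos_series_sums[of x] unfolding sums_def by (intro tendsto_intros)
  qed
  thus ?thesis unfolding sums_def integral_unique[OF hN] .
qed

text \<open>Euler--Maclaurin summation of order two: on \<open>[m, m + 1]\<close> the second periodic Bernoulli
  function is \<open>cos_series x / pi\<^sup>2\<close>, and the function \<open>F\<close> in the proof is an explicit antiderivative.\<close>

lemma hurwitz_sums:
  fixes a :: nat
  assumes s: "Re s > 1" and a: "a > 0"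
  shows "(\<lambda>n. of_nat (a + n) powr (- s)) sums
    (of_nat a powr (1 - s) / (s - 1) + of_nat a powr (- s) / 2 + s / 12 * of_nat a powr (- s - 1)
     - s * (s + 1) / (2 * of_real pi ^ 2) * (\<Sum>n. osc (Suc n * a) s / of_nat (Suc n) ^ 2 * of_nat a powr (- s - 1)))"
proof -
  define g where "g = (\<lambda>x. of_real (cos_series x) * of_real x powr (- s - 2) :: complex)"
  define K where "K = s * (s + 1) / (2 * of_real pi ^ 2)"
  \<comment> \<open>The boundary part of Euler--Maclaurin: 1/12 is B_2(0)/2, 1/2 is B_1 at the right
    end of a unit interval, and the last term is an antiderivative of x^(-s).\<close>
  define E where "E x = - s / 12 * of_real x powr (- s - 1) - of_real x powr (- s) / 2 - of_real x powr (1 - s) / (s - 1)" for x :: real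
  have A: "real a > 0" using a by simp
  have s1: "s - 1 \<noteq> 0" "s \<noteq> 1" using s by auto
  have gc: "continuous_on {x..} g" "continuous_on {x..y} g" if "x > 0" for x y
    unfolding g_def using that by (auto intro!: continuous_intros continuous_on_cos_series)
  have step: "K * integral {real m..real m + 1} g = E (real m + 1) - E (real m) - of_nat m powr (-s)" if m: "m > 0" for m
  proof -
    define F where "F x = of_real (((x - real m)\<^sup>2 - (x - real m) + 1/6) / 2) * (- s * of_real x powr (-s-1))
      - of_real (x - real m - 1/2) * of_real x powr (-s) - of_real x powr (1 - s) / (s - 1)" for x :: real
    have "((\<lambda>x. K * g x) has_integral (F (real m + 1) - F (real m))) {real m..real m + 1}"
    proof (rule fundamental_theorem_of_calculus)
      fix x assume x: "x \<in> {real m..real m + 1}"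
      hence x0: "x > 0" using m by auto
      have p: "((\<lambda>x. of_real x powr z :: complex) has_vector_derivative z * of_real x powr (z - 1)) (at x)" for z
        using has_field_derivative_powr[of "of_real x" z] x0
        by (intro has_vector_derivative_real_field) (auto simp: complex_nonpos_Reals_iff)
      have b2: "((\<lambda>x. of_real (((x - real m)\<^sup>2 - (x - real m) + 1/6) / 2) :: complex) has_vector_derivative of_real (x - real m - 1/2)) (at x)"
        by (intro has_vector_derivative_of_real) (auto intro!: derivative_eq_intros simp: field_simps)
      have b1: "((\<lambda>x. of_real (x - real m - 1/2) :: complex) has_vector_derivative of_real 1) (at x)"
        by (intro has_vector_derivative_of_real) (auto intro!: derivative_eq_intros)
      have gx: "g x = of_real pi ^ 2 * of_real ((x - real m)\<^sup>2 - (x - real m) + 1 / 6) * of_real x powr (- s - 2)"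
        using cos_series_eq[of m x] x by (simp add: g_def)
      have "K * g x = s * (s + 1) / 2 * of_real ((x - real m)\<^sup>2 - (x - real m) + 1 / 6) * of_real x powr (- s - 2)"
      proof -
        have "s * (s + 1) / (2 * P) * (P * B * Y) = s * (s + 1) / 2 * B * Y" if "P \<noteq> 0" for P B Y :: complex
          using that by simp
        note * = this
        show ?thesis unfolding gx K_def by (rule *) simp
      qed
      also have "\<dots> = of_real (((x - real m)\<^sup>2 - (x - real m) + 1/6) / 2) * (- s * ((-s-1) * of_real x powr (- s - 2)))"
      proof -
        have "s * (s + 1) / 2 * of_real C * Y = of_real (C / 2) * (- s * ((-s-1) * Y))" for C and Y :: complex
          by (simp add: field_simps)
        thus ?thesis .
      qed
      finally have Kg: "K * g x = of_real (((x - real m)\<^sup>2 - (x - real m) + 1/6) / 2) * (- s * ((-s-1) * of_real x powr (- s - 2)))" .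
      have q: "((\<lambda>x. of_real x powr (-s-1) :: complex) has_vector_derivative (-s-1) * of_real x powr (-s-2)) (at x)"
        "((\<lambda>x. of_real x powr (-s) :: complex) has_vector_derivative (-s) * of_real x powr (-s-1)) (at x)"
        "((\<lambda>x. of_real x powr (1-s) :: complex) has_vector_derivative (1-s) * of_real x powr (-s)) (at x)"
      proof -
        have e: "- s - 1 - 1 = - s - 2" by simp
        show "((\<lambda>x. of_real x powr (-s-1) :: complex) has_vector_derivative (-s-1) * of_real x powr (-s-2)) (at x)"
          using p[of "-s-1"] unfolding e .
      qed (use p[of "-s"] p[of "1-s"] in simp_all)
      have c: "(1 - s) * of_real x powr (-s) / (s - 1) = - (of_real x powr (-s) :: complex)"
        using s1 by (simp add: divide_simps) (simp add: algebra_simps)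
      have "(F has_vector_derivative K * g x) (at x)"
        unfolding F_def
        by (rule has_vector_derivative_eq_rhs,
            rule has_vector_derivative_diff[OF has_vector_derivative_diff[OF
              has_vector_derivative_mult[OF b2 has_vector_derivative_mult_right[OF q(1)]]
              has_vector_derivative_mult[OF b1 q(2)]] has_vector_derivative_divide[OF q(3)]])
           (unfold c Kg, simp add: algebra_simps)
      thus "(F has_vector_derivative K * g x) (at x within {real m..real m + 1})"
        by (rule has_vector_derivative_at_within)
    qed simp
    moreover have "((\<lambda>x. K * g x) has_integral K * integral {real m..real m + 1} g) {real m..real m + 1}"
      using m by (intro has_integral_mult_right integrable_integral integrable_continuous_real gc) auto
    ultimately have "K * integral {real m..real m + 1} g = F (real m + 1) - F (real m)"
      using has_integral_unique by blast
    \<comment> \<open>\<open>F\<close> equals \<open>E\<close> at the right end but exceeds it by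
      \<open>of_nat m powr (-s)\<close> at the left end, because x - m - 1/2 goes from -1/2 to 1/2.
      This jump produces the summand; the rest telescopes.\<close>
    also have "\<dots> = E (real m + 1) - E (real m) - of_nat m powr (-s)"
      by (simp add: F_def E_def field_simps power2_eq_square)
    finally show ?thesis .
  qed
  have part: "(\<Sum>j<M. of_nat (a + j) powr (- s)) = E (real (a + M)) - E (real a) - K * integral {real a..real (a + M)} g" for M
  proof (induction M)
    case (Suc M)
    have "integral {real a..real (a + Suc M)} g = integral {real a..real (a + M)} g + integral {real (a+M)..real (a + Suc M)} g"
      by (rule Henstock_Kurzweil_Integration.integral_combine[symmetric])
         (use A in \<open>auto intro!: integrable_continuous_real gc\<close>)
    hence "K * integral {real a..real (a + Suc M)} g = K * integral {real a..real (a + M)} g + K * integral {real (a+M)..real (a + M) + 1} g"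
      by (simp add: algebra_simps)
    also have "K * integral {real (a+M)..real (a + M) + 1} g = E (real (a+M) + 1) - E (real (a+M)) - of_nat (a+M) powr (-s)"
      by (rule step) (use a in simp)
    finally have eq: "K * integral {real a..real (a + Suc M)} g = K * integral {real a..real (a + M)} g
      + (E (real (a+M) + 1) - E (real (a+M)) - of_nat (a+M) powr (-s))" .
    have r: "real (a + Suc M) = real (a + M) + 1" by simp
    show ?case by (simp only: sum.lessThan_Suc Suc.IH eq) (simp only: r, simp)
  qed simp
  have cs: "norm (g x) \<le> pi\<^sup>2 / 6 * x powr - (Re s + 2)" if "x \<ge> real a" for x
    using that A abs_cos_series_le[of x] unfolding g_def norm_mult
    by (simp add: norm_of_real_powr mult_right_mono)
  have gi: "((\<lambda>b. integral {real a..b} g) \<longlongrightarrow> integral {real a..} g) at_top"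
    by (rule integral_tail_powr_tendsto[OF A _ gc(1)[OF A] cs]) (use s in auto)
  have aM: "filterlim (\<lambda>M. real (a + M)) at_top sequentially"
    by (intro filterlim_compose[OF filterlim_real_sequentially] filterlim_add_const_nat_at_top[THEN filterlim_cong[THEN iffD1, rotated -1]])
       (auto simp: add.commute)
  have gi': "(\<lambda>M. integral {real a..real (a + M)} g) \<longlonglongrightarrow> integral {real a..} g"
    by (rule filterlim_compose[OF gi aM])
  have pw: "(\<lambda>M. of_real (real (a + M)) powr z) \<longlonglongrightarrow> (0::complex)" if "Re z < 0" for z
  proof (rule tendsto_norm_zero_cancel)
    have "(\<lambda>M. real (a + M) powr Re z) \<longlonglongrightarrow> 0"
      by (rule tendsto_neg_powr[OF that aM])
    thus "(\<lambda>M. norm (of_real (real (a + M)) powr z :: complex)) \<longlonglongrightarrow> 0"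
      using a by (subst norm_of_real_powr) auto
  qed
  have "(\<lambda>M. E (real (a + M))) \<longlonglongrightarrow> - s / 12 * 0 - 0 / 2 - 0 / (s - 1)"
    unfolding E_def using s s1 by (intro tendsto_intros pw) auto
  hence "(\<lambda>M. \<Sum>j<M. of_nat (a + j) powr (- s)) \<longlonglongrightarrow> 0 - E (real a) - K * integral {real a..} g"
    unfolding part by (intro tendsto_intros gi') simp
  moreover have "integral {real a..} g = (\<Sum>n. osc (Suc n * a) s / of_nat (Suc n) ^ 2 * of_nat a powr (- s - 1))"
    unfolding g_def by (rule sums_unique, rule cos_series_powr_sums) (use s a in auto)
  ultimately show ?thesis unfolding sums_def K_def by (simp add: E_def algebra_simps)
qed

section \<open>Continuation of zeta\<close>

text \<open>The factor accumulated by j uses of \<open>osc_recursion\<close>: (-1)^j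
  (s+2)(s+3)...(s+2j+1) / (2 pi)^(2j).\<close>

primrec osc_coeff :: "nat \<Rightarrow> complex \<Rightarrow> complex" where
  "osc_coeff 0 s = 1"
| "osc_coeff (Suc j) s = - osc_coeff j s * (s + of_nat (2*j+2)) * (s + of_nat (2*j+3)) / (4 * of_real pi ^ 2)"

lemma osc_coeff_holomorphic: "osc_coeff j holomorphic_on A"
  by (induction j) (auto intro!: holomorphic_intros)

text \<open>Repeated integration by parts trades convergence at \<open>n = \<infinity>\<close> for Dirichlet series in the
  coefficients.\<close>

lemma osc_series_expand:
  assumes s: "Re s \<ge> 0" and summ: "summable (\<lambda>n. norm (c n) / real (Suc n) ^ 4)"
  shows "(\<lambda>n. c n / of_nat (Suc n) ^ 2 * osc (Suc n) s) sums
    ((\<Sum>j<J. osc_coeff j s * ((s + of_nat (2*j+2)) / (4 * of_real pi ^ 2)) * (\<Sum>n. c n / of_nat (Suc n) ^ (2*j+4)))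
     + osc_coeff J s * (\<Sum>n. c n / of_nat (Suc n) ^ (2*J+2) * osc (Suc n) (s + of_nat (2*J))))"
proof -
  define D where "D j = (\<Sum>n. c n / of_nat (Suc n) ^ (2*j+4))" for j
  define S where "S j = (\<Sum>n. c n / of_nat (Suc n) ^ (2*j+2) * osc (Suc n) (s + of_nat (2*j)))" for j
  have Dle: "norm (c n / of_nat (Suc n) ^ (2*j+4)) \<le> norm (c n) / real (Suc n) ^ 4" for n j
    by (simp add: norm_divide norm_power del: of_nat_Suc) (intro divide_left_mono power_increasing, auto)
  have Dsumm: "(\<lambda>n. c n / of_nat (Suc n) ^ (2*j+4)) sums D j" for j
    unfolding D_def by (rule summable_sums, rule summable_comparison_test'[OF summ]) (rule Dle)
  \<comment> \<open>From index 1 on every series carries at least the fourth power and is covered by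
    \<open>summ\<close>. The original series, with the square only, has no such majorant here; it
    inherits convergence through the recursion in \<open>step\<close>.\<close>
  have S'summ: "(\<lambda>n. c n / of_nat (Suc n) ^ (2*Suc j+2) * osc (Suc n) (s + of_nat (2*Suc j))) sums S (Suc j)" for j
    unfolding S_def
  proof (rule summable_sums, rule summable_comparison_test'[OF summ])
    fix n
    have "norm (osc (Suc n) (s + of_nat (2*Suc j))) \<le> 1 / (Re (s + of_nat (2*Suc j)) + 1)"
      by (rule norm_osc_le) (use s in auto)
    also have "\<dots> \<le> 1" using s by simp
    finally have "norm (c n / of_nat (Suc n) ^ (2*j+4) * osc (Suc n) (s + of_nat (2*Suc j))) \<le> norm (c n) / real (Suc n) ^ 4 * 1"
      unfolding norm_mult using Dle by (intro mult_mono) auto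
    moreover have "2 * j + 4 = 2 * Suc j + 2" by simp
    ultimately show "norm (c n / of_nat (Suc n) ^ (2*Suc j+2) * osc (Suc n) (s + of_nat (2*Suc j))) \<le> norm (c n) / real (Suc n) ^ 4"
      by (simp only: mult_1_right)
  qed
  have step: "(\<lambda>n. c n / of_nat (Suc n) ^ (2*j+2) * osc (Suc n) (s + of_nat (2*j))) sums
     ((s + of_nat (2*j+2)) / (4 * of_real pi ^ 2) * D j -
      (s + of_nat (2*j+2)) * (s + of_nat (2*j+3)) / (4 * of_real pi ^ 2) * S (Suc j))" for j
  proof -
    have "c n / of_nat (Suc n) ^ (2*j+2) * osc (Suc n) (s + of_nat (2*j)) =
      (s + of_nat (2*j+2)) / (4 * of_real pi ^ 2) * (c n / of_nat (Suc n) ^ (2*j+4)) -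
      (s + of_nat (2*j+2)) * (s + of_nat (2*j+3)) / (4 * of_real pi ^ 2) * (c n / of_nat (Suc n) ^ (2*Suc j+2) * osc (Suc n) (s + of_nat (2*Suc j)))" for n
    proof -
      define N :: complex where "N = of_nat (Suc n)"
      have pw: "N ^ (2*j+4) = N ^ (2*j+2) * N\<^sup>2"
      proof -
        have "2 * j + 4 = (2 * j + 2) + 2" by simp
        thus ?thesis by (simp only: power_add)
      qed
      have "osc (Suc n) (s + of_nat (2*j)) = (s + of_nat (2*j+2)) / (4 * of_real pi ^ 2 * N\<^sup>2) * (1 - (s + of_nat (2*j+3)) * osc (Suc n) (s + of_nat (2*Suc j)))"
        using osc_recursion[of "s + of_nat (2*j)" "Suc n"] s by (simp add: N_def add_ac)
      moreover have "x / P * (a / (q * M) * (1 - b * y)) = a / q * (x / (P * M)) - a * b / q * (x / (P * M) * y)"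
        for x P a q M b y :: complex
        by (simp add: right_diff_distrib diff_divide_distrib mult_ac)
      moreover have "2 * Suc j + 2 = 2 * j + 4" by simp
      ultimately show ?thesis unfolding N_def[symmetric] by (simp only: pw)
    qed
    thus ?thesis by (simp only:) (intro sums_diff sums_mult Dsumm S'summ)
  qed
  have Seq: "S j = (s + of_nat (2*j+2)) / (4 * of_real pi ^ 2) * D j -
      (s + of_nat (2*j+2)) * (s + of_nat (2*j+3)) / (4 * of_real pi ^ 2) * S (Suc j)" for j
    using step[of j] unfolding S_def[of j] by (rule sums_unique[symmetric])
  have "S 0 = (\<Sum>j<J. osc_coeff j s * ((s + of_nat (2*j+2)) / (4 * of_real pi ^ 2)) * D j) + osc_coeff J s * S J"
  proof (induction J)
    case (Suc J)
    have e: "Q * (a / p * d - a * b / p * t) = Q * (a / p) * d + - Q * a * b / p * t" for Q a p d b t :: complex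
      by (simp add: right_diff_distrib mult_ac)
    show ?case unfolding Suc.IH Seq[of J] e sum.lessThan_Suc osc_coeff.simps by (simp only: add.assoc)
  qed simp
  moreover have "(\<lambda>n. c n / of_nat (Suc n) ^ 2 * osc (Suc n) s) sums S 0"
    unfolding Seq[of 0] using step[of 0]
    by (simp only: mult_0_right add_0_left of_nat_0 add_0_right)
  ultimately show ?thesis unfolding D_def S_def by simp
qed

text \<open>The shift by 2J moves the argument of \<open>osc\<close> to positive real part, where
  its norm is at most 1. A majorant for the coefficients alone therefore gives uniform
  convergence.\<close>

lemma osc_series_holomorphic:
  assumes hol: "\<And>n. c n holomorphic_on {s. Re s > b}" and b: "b + real (2*J) \<ge> 0"
    and M: "summable M" "\<And>n s. Re s > b \<Longrightarrow> norm (c n s) / real (Suc n) ^ (2*J+2) \<le> M n"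
  shows "(\<lambda>s. \<Sum>n. c n s / of_nat (Suc n) ^ (2*J+2) * osc (Suc n) (s + of_nat (2*J))) holomorphic_on {s. Re s > b}"
proof (rule holomorphic_uniform_sequence)
  define f where "f n s = c n s / of_nat (Suc n) ^ (2*J+2) * osc (Suc n) (s + of_nat (2*J))" for n s
  show "open {s. Re s > b}" by (rule open_halfspace_Re_gt)
  have "(\<lambda>s. osc (Suc n) (s + of_nat (2*J))) holomorphic_on {s. Re s > b}" for n
    using holomorphic_on_compose_gen[OF _ osc_holomorphic[of "Suc n"], of "\<lambda>s. s + of_nat (2*J)" "{s. Re s > b}"] b
    by (force simp: o_def intro: holomorphic_intros)
  hence "f n holomorphic_on {s. Re s > b}" for n
    unfolding f_def by (intro holomorphic_intros hol) auto
  thus "(\<lambda>s. \<Sum>n<N. c n s / of_nat (Suc n) ^ (2*J+2) * osc (Suc n) (s + of_nat (2*J))) holomorphic_on {s. Re s > b}" for N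
    unfolding f_def[symmetric] by (rule holomorphic_on_sum)
  fix s assume "s \<in> {s. Re s > b}"
  then obtain d where d: "d > 0" "cball s d \<subseteq> {s. Re s > b}"
    using open_contains_cball open_halfspace_Re_gt[of b] by blast
  have "norm (f n z) \<le> M n" if "z \<in> cball s d" for n z
  proof -
    have z: "Re z > b" using d that by auto
    have "norm (osc (Suc n) (z + of_nat (2*J))) \<le> 1 / (Re (z + of_nat (2*J)) + 1)"
      by (rule norm_osc_le) (use z b in auto)
    also have "\<dots> \<le> 1" using z b by simp
    finally have "norm (f n z) \<le> M n * 1"
      unfolding f_def norm_mult using M(2)[OF z, of n]
      unfolding norm_divide norm_power norm_of_nat
      by (intro mult_mono) (auto intro: order_trans[rotated])
    thus ?thesis by simp
  qed
  note lim = Weierstrass_m_test[OF this M(1), unfolded f_def]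
  show "\<exists>d>0. cball s d \<subseteq> {s. Re s > b} \<and> uniform_limit (cball s d) (\<lambda>N s. \<Sum>n<N. c n s / of_nat (Suc n) ^ (2*J+2) * osc (Suc n) (s + of_nat (2*J)))
     (\<lambda>s. \<Sum>n. c n s / of_nat (Suc n) ^ (2*J+2) * osc (Suc n) (s + of_nat (2*J))) sequentially"
    by (rule exI[of _ d], intro conjI d lim)
qed

lemma zeta_continuation:
  "zeta nicely_meromorphic_on UNIV \<and>
   (\<forall>s. Re s > 1 \<longrightarrow> zeta s = (\<Sum>n. of_nat (Suc n) powr (-s))) \<and> (\<forall>s. s \<noteq> 1 \<longrightarrow> zeta analytic_on {s})"
proof -
  define D where "D j = (\<Sum>n. 1 / of_nat (Suc n) ^ (2*j+4) :: complex)" for j :: nat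
  define S where "S J s = (\<Sum>n. 1 / of_nat (Suc n) ^ (2*J+2) * osc (Suc n) (s + of_nat (2*J)))" for J s
  define R where "R J s = (\<Sum>j<J. osc_coeff j s * ((s + of_nat (2*j+2)) / (4 * of_real pi ^ 2)) * D j) + osc_coeff J s * S J s" for J s
  \<comment> \<open>The right-hand side of \<open>hurwitz_sums\<close> at a = 1, with the
    oscillating sum expanded to depth J. The coefficients being 1, every \<open>D j\<close> is a
    constant, and 1 / (s - 1) is the only singular term.\<close>
  define h where "h J s = 1 / (s - 1) + 1 / 2 + s / 12 - s * (s + 1) / (2 * of_real pi ^ 2) * R J s" for J s
  define f :: "complex \<Rightarrow> complex" where "f s = (\<Sum>n. of_nat (Suc n) powr (-s))" for s
  have p4: "norm (1::complex) / real (Suc n) ^ (2*J+2) \<le> 1 / real (Suc n) ^ 2" for n J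
  proof -
    have "real (Suc n) ^ 2 \<le> real (Suc n) ^ (2*J+2)" by (rule power_increasing) auto
    thus ?thesis unfolding norm_one by (intro divide_left_mono) auto
  qed
  have Shol: "S J holomorphic_on {s. Re s > - real J}" for J
    unfolding S_def
    by (rule osc_series_holomorphic[OF _ _ summable_inverse_squares_Suc]) (use p4 in auto)
  have Rhol: "R J holomorphic_on {s. Re s > - real J}" for J
    unfolding R_def by (intro holomorphic_intros osc_coeff_holomorphic Shol) auto
  have han: "h J analytic_on {s. Re s > - real J} - {1}" for J
  proof (subst analytic_on_open)
    show "open ({s. Re s > - real J} - {1})" by (intro open_Diff open_halfspace_Re_gt) auto
    show "h J holomorphic_on {s. Re s > - real J} - {1}"
      unfolding h_def by (intro holomorphic_intros holomorphic_on_subset[OF Rhol[of J]]) auto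
  qed
  have hmer: "h J meromorphic_on {s. Re s > - real J}" for J
    unfolding h_def
    by (intro meromorphic_intros analytic_on_imp_meromorphic_on[of "R J"])
       (use Rhol[of J] in \<open>auto simp: analytic_on_open open_halfspace_Re_gt intro!: analytic_intros\<close>)
  have hf: "h J s = f s" if s: "Re s > 1" for J s
  proof -
    have "summable (\<lambda>n. norm (1::complex) / real (Suc n) ^ 4)"
      by (rule summable_comparison_test'[OF summable_inverse_squares_Suc]) (use p4[of _ 1] in simp)
    from osc_series_expand[OF _ this, of s J] s
    have R: "R J s = (\<Sum>n. 1 / of_nat (Suc n) ^ 2 * osc (Suc n) s)"
      unfolding R_def D_def S_def by (simp add: sums_iff del: of_nat_Suc)
    show ?thesis
      using hurwitz_sums[OF s, of 1] unfolding h_def f_def R by (simp add: sums_iff)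
  qed
  obtain g where g: "g nicely_meromorphic_on UNIV"
    "\<And>n s. Re s > - real n \<Longrightarrow> h n analytic_on {s} \<Longrightarrow> g s = h n s"
    "\<And>n s. Re s > - real n \<Longrightarrow> h n analytic_on {s} \<Longrightarrow> g analytic_on {s}"
    by (rule nicely_meromorphic_glue[OF hmer hf]) (assumption, rule that)
  have han': "h J analytic_on {s}" if "Re s > - real J" "s \<noteq> 1" for J s
    by (rule analytic_on_subset[OF han]) (use that in auto)
  have gf: "g s = f s" if "Re s > 1" for s
    using g(2)[of 0 s] han'[of 0 s] hf[OF that, of 0] that by (cases "s = 1") auto
  have "zeta = g"
    unfolding zeta_def
    by (rule meromorphic_continuation_unique[OF g(1) open_halfspace_Re_gt])
       (use gf in \<open>auto simp: f_def intro: exI[of _ 2]\<close>)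
  moreover have "g analytic_on {s}" if "s \<noteq> 1" for s
  proof (rule g(3))
    show "Re s > - real (nat \<lceil>\<bar>Re s\<bar>\<rceil> + 1)" by simp linarith
    thus "h (nat \<lceil>\<bar>Re s\<bar>\<rceil> + 1) analytic_on {s}" using that by (rule han')
  qed
  ultimately show ?thesis using g(1) gf by (auto simp: f_def)
qed

lemmas zeta_nicely_meromorphic = zeta_continuation[THEN conjunct1]

lemma zeta_analytic: "s \<noteq> 1 \<Longrightarrow> zeta analytic_on {s}"
  using zeta_continuation by blast

lemma zeta_sums:
  assumes "Re s > 1"
  shows "(\<lambda>n. of_nat (Suc n) powr (-s)) sums zeta s"
  using zeta_continuation hurwitz_sums[OF assms, of 1] assms by (auto simp: sums_iff)

section \<open>Regrouping double series\<close>

lemma summable_inverse_powr_Suc: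
  assumes "r > 1"
  shows "summable (\<lambda>n. real (Suc n) powr (-r))"
  using assms summable_real_powr_iff[of "-r"] summable_Suc_iff[of "\<lambda>n. real n powr (-r)"] by simp

lemma norm_of_nat_powr: "n > 0 \<Longrightarrow> norm (of_nat n powr z :: complex) = real n powr Re z"
  using norm_of_real_powr[of "real n" z] by simp

lemma of_nat_power_powr:
  "m > 0 \<Longrightarrow> of_nat (m ^ q) powr z = (of_nat m powr (of_nat q * z) :: complex)"
  using Ln_of_nat[of "m ^ q"] Ln_of_nat[of m] by (simp add: powr_def ln_realpow mult_ac)

lemma has_sum_atLeast_shift:
  fixes f :: "nat \<Rightarrow> 'a :: banach"
  assumes "summable (\<lambda>n. norm (f (a + n)))" "(\<lambda>n. f (a + n)) sums S"
  shows "(f has_sum S) {a..}"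
proof -
  have "bij_betw (\<lambda>n. a + n) UNIV {a..}"
    by (rule bij_betwI[of _ _ _ "\<lambda>n. n - a"]) auto
  from has_sum_reindex_bij_betw[OF this, of f S] norm_summable_imp_has_sum[OF assms]
  show ?thesis by simp
qed

lemma has_sum_atLeast1_imp_sums:
  fixes f :: "nat \<Rightarrow> 'a :: {topological_comm_monoid_add, t2_space}"
  assumes "(f has_sum S) {1..}"
  shows "(\<lambda>n. f (Suc n)) sums S"
proof -
  have "bij_betw Suc UNIV {1..}"
    by (rule bij_betwI[of _ _ _ "\<lambda>n. n - 1"]) auto
  from has_sum_reindex_bij_betw[OF this, of f S] assms
  show ?thesis by (intro has_sum_imp_sums) simp
qed

text \<open>\<open>has_sum\<close> does not depend on an order of summation, so the index set can be
  cut into finite fibres over N.\<close>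

lemma sums_regroup:
  fixes f :: "'b \<Rightarrow> 'a :: real_normed_vector"
  assumes f: "(f has_sum S) B" and bij: "bij_betw \<phi> (Sigma {1..} D) B"
    and fin: "\<And>N. N \<ge> 1 \<Longrightarrow> finite (D N)"
  shows "(\<lambda>N. \<Sum>d\<in>D (Suc N). f (\<phi> (Suc N, d))) sums S"
proof (rule has_sum_atLeast1_imp_sums)
  have "((\<lambda>x. f (\<phi> x)) has_sum S) (Sigma {1..} D)"
    using has_sum_reindex_bij_betw[OF bij, of f S] f by simp
  thus "((\<lambda>N. \<Sum>d\<in>D N. f (\<phi> (N, d))) has_sum S) {1..}"
    by (rule has_sum_SigmaD) (use fin in \<open>auto intro!: has_sum_finite\<close>)
qed

text \<open>Evaluation of the same kind of double sum row by row. Played against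
  \<open>sums_regroup\<close> it gives identities: one double series, two values.\<close>

lemma sums_iterated:
  fixes f :: "nat \<times> 'b \<Rightarrow> 'a :: real_normed_vector"
  assumes "(f has_sum S) (Sigma {1..} C)" "\<And>m. m \<ge> 1 \<Longrightarrow> ((\<lambda>y. f (m, y)) has_sum g m) (C m)"
  shows "(\<lambda>m. g (Suc m)) sums S"
  by (rule has_sum_atLeast1_imp_sums, rule has_sum_SigmaD[OF assms(1)]) (use assms(2) in auto)

lemma has_sum_product_majorant:
  fixes f :: "nat \<times> nat \<Rightarrow> 'a :: banach"
  assumes u: "summable (\<lambda>n. u (Suc n))" "\<And>m. u m \<ge> (0::real)"
    and v: "summable (\<lambda>n. v (Suc n))" "\<And>m. v m \<ge> (0::real)"
    and B: "B \<subseteq> {1..} \<times> {1..}"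
    and le: "\<And>m n. (m, n) \<in> B \<Longrightarrow> norm (f (m, n)) \<le> u m * v n"
  shows "(f has_sum infsum f B) B"
proof -
  have h: "(w has_sum (\<Sum>n. w (Suc n))) {1..}" if "summable (\<lambda>n. w (Suc n))" "\<And>m. w m \<ge> (0::real)" for w
    by (rule has_sum_atLeast_shift) (use that in \<open>auto simp: summable_sums\<close>)
  have "(\<lambda>(m, n). u m * v n) summable_on ({1..} \<times> {1..})"
  proof (rule summable_on_SigmaI)
    show "((\<lambda>n. case (m, n) of (m, n) \<Rightarrow> u m * v n) has_sum (u m * (\<Sum>n. v (Suc n)))) {1..}" for m
      unfolding prod.case by (intro has_sum_cmult_right h v)
    show "(\<lambda>m. u m * (\<Sum>n. v (Suc n))) summable_on {1..}"
      using h[OF u] by (intro summable_on_cmult_left) (auto simp: summable_on_def)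
  qed (use u v in auto)
  hence "(\<lambda>(m, n). u m * v n) summable_on B" by (rule summable_on_subset[OF _ B])
  hence "(\<lambda>x. norm (f x)) summable_on B"
    by (rule Infinite_Sum.abs_summable_on_comparison_test') (use le in auto)
  thus ?thesis by (intro has_sum_infsum) (rule Infinite_Sum.abs_summable_summable)
qed

lemma power_dvd_imp_le:
  fixes d N :: nat
  assumes "q \<ge> 1" "N > 0" "d > 0" "d ^ q dvd N"
  shows "d \<le> N"
proof -
  have "d \<le> d ^ q" using assms self_le_power[of d q] by simp
  also have "\<dots> \<le> N" using assms by (intro dvd_imp_le) auto
  finally show ?thesis .
qed

lemma finite_power_divisors:
  assumes "q \<ge> 1" "N \<ge> (1::nat)"
  shows "finite {d. d > 0 \<and> d ^ q dvd N}"
  by (rule finite_subset[of _ "{..N}"]) (use assms power_dvd_imp_le[of q N] in auto)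

lemma sums_regroup_power_divisors:
  fixes f :: "nat \<times> nat \<Rightarrow> 'a :: real_normed_vector"
  assumes q: "q \<ge> 1" and f: "(f has_sum S) ({1..} \<times> {1..})"
  shows "(\<lambda>N. \<Sum>d | d > 0 \<and> d ^ q dvd Suc N. f (d, Suc N div d ^ q)) sums S"
proof -
  have "bij_betw (\<lambda>(N::nat, d::nat). (d, N div d ^ q)) (Sigma {1..} (\<lambda>N. {d. d > 0 \<and> d ^ q dvd N})) ({1..} \<times> {1..})"
    by (rule bij_betwI[of _ _ _ "\<lambda>(m, n). (n * m ^ q, m)"])
       (auto simp: Suc_le_eq dvd_imp_le div_greater_zero_iff)
  from sums_regroup[OF f this] finite_power_divisors[OF q] show ?thesis by simp
qed

text \<open>Pairs (m, l) with l >= m^q are sorted by j = m l. The condition turns into m^(q+1) <= j,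
  that is m <= j^(1/k) with k = q + 1.\<close>

lemma sums_regroup_root_divisors:
  fixes f :: "nat \<times> nat \<Rightarrow> 'a :: real_normed_vector"
  assumes f: "(f has_sum S) (Sigma {1..} (\<lambda>m. {m ^ q..}))"
  shows "(\<lambda>j. \<Sum>d | d > 0 \<and> d dvd Suc j \<and> d ^ Suc q \<le> Suc j. f (d, Suc j div d)) sums S"
proof -
  have pos: "b > 0" if "a > 0" "a ^ q \<le> b" for a b :: nat
    by (rule less_le_trans[OF zero_less_power[OF that(1)] that(2)])
  have bij: "bij_betw (\<lambda>(j::nat, d::nat). (d, j div d)) (Sigma {1..} (\<lambda>j. {d. d > 0 \<and> d dvd j \<and> d ^ Suc q \<le> j})) (Sigma {1..} (\<lambda>m. {m ^ q..}))"
    by (rule bij_betwI[of _ _ _ "\<lambda>(m, l). (m * l, m)"])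
       (auto simp: Suc_le_eq div_greater_zero_iff less_eq_div_iff_mult_less_eq mult.commute intro: pos)
  have fin: "finite {d. d > 0 \<and> d dvd j \<and> d ^ Suc q \<le> j}" if "j \<ge> 1" for j :: nat
    by (rule finite_subset[of _ "{..j}"]) (use that in \<open>auto dest: dvd_imp_le\<close>)
  show ?thesis using sums_regroup[OF f bij fin] by simp
qed

lemma root_divisor_count_eq:
  assumes "j > 0"
  shows "root_divisor_count (Suc q) j = card {d. d > 0 \<and> d dvd j \<and> d ^ Suc q \<le> j}"
proof -
  have "real d \<le> real j powr (1 / real (Suc q)) \<longleftrightarrow> d ^ Suc q \<le> j" for d
  proof -
    have "real d \<le> real j powr (1 / real (Suc q)) \<longleftrightarrow> real d \<le> root (Suc q) (real j)"
      using assms by (simp add: root_powr_inverse)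
    also have "\<dots> \<longleftrightarrow> root (Suc q) (real d ^ Suc q) \<le> root (Suc q) (real j)"
      by (simp only: real_root_power_cancel[OF zero_less_Suc of_nat_0_le_iff])
    also have "\<dots> \<longleftrightarrow> real (d ^ Suc q) \<le> real j"
      by (simp only: real_root_le_iff[OF zero_less_Suc] of_nat_power)
    finally show ?thesis by (simp only: of_nat_le_iff)
  qed
  thus ?thesis by (simp add: root_divisor_count_def)
qed

lemma zeta_sums':
  assumes "Re z < -1"
  shows "(\<lambda>n. of_nat (Suc n) powr z) sums zeta (- z)"
  using zeta_sums[of "-z"] assms by simp

text \<open>Writing m^k + mn = m l with l = m^q + n, the double series of (m l)^(-s) over l >= m^q
  is evaluated twice: the fibres of m l give the divisor count, and the rows give Hurwitz sums
  starting at m^q.\<close>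

lemma root_divisor_series_eq:
  fixes q :: nat
  assumes q: "q \<ge> 1" and s: "Re s > 1"
  defines "k \<equiv> Suc q"
  shows "(\<lambda>j. of_nat (root_divisor_count k (Suc j)) * of_nat (Suc j) powr (-s)) sums
     (1 / 2 * zeta (of_nat k * s) + zeta (of_nat k * s - of_nat q) / (s - 1)
      + s / 12 * zeta (of_nat k * s + of_nat q)
      - s * (s + 1) / (2 * of_real pi ^ 2) *
        (\<Sum>n. sigma_pow q (of_nat q - of_nat k * s) (Suc n) / of_nat (Suc n) ^ 2 * osc (Suc n) s))"
proof -
  define K where "K = s * (s + 1) / (2 * of_real pi ^ 2)"
  define B where "B = Sigma {1..} (\<lambda>m::nat. {m ^ q..})"
  define f :: "nat \<times> nat \<Rightarrow> complex" where "f = (\<lambda>(m, l). of_nat (m * l) powr (-s))"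
  have sr: "summable (\<lambda>n. real (Suc n) powr - Re s)" by (rule summable_inverse_powr_Suc[OF s])
  have fB: "(f has_sum infsum f B) B"
  proof (rule has_sum_product_majorant[OF sr _ sr])
    show "norm (f (m, n)) \<le> real m powr - Re s * real n powr - Re s" if "(m, n) \<in> B" for m n
    proof -
      have "m > 0" using that by (auto simp: B_def)
      moreover have "n > 0"
        using that \<open>m > 0\<close> less_le_trans[OF zero_less_power[of m q]] by (auto simp: B_def)
      ultimately show ?thesis by (simp add: f_def norm_of_nat_powr powr_mult del: of_nat_mult) (simp add: powr_mult)
    qed
    show "B \<subseteq> {1..} \<times> {1..}"
      using less_le_trans[OF zero_less_power] by (fastforce simp: B_def Suc_le_eq)
  qed auto
  have lhs: "(\<lambda>j. of_nat (root_divisor_count k (Suc j)) * of_nat (Suc j) powr (-s)) sums infsum f B"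
  proof -
    have "(\<Sum>d | d > 0 \<and> d dvd Suc j \<and> d ^ Suc q \<le> Suc j. f (d, Suc j div d))
        = of_nat (root_divisor_count k (Suc j)) * of_nat (Suc j) powr (-s)" for j
    proof -
      have "(\<Sum>d | d > 0 \<and> d dvd Suc j \<and> d ^ Suc q \<le> Suc j. f (d, Suc j div d))
          = (\<Sum>d | d > 0 \<and> d dvd Suc j \<and> d ^ Suc q \<le> Suc j. of_nat (Suc j) powr (-s))"
        by (rule sum.cong) (auto simp: f_def simp del: of_nat_mult of_nat_Suc)
      thus ?thesis by (simp add: k_def root_divisor_count_eq del: of_nat_Suc power_Suc)
    qed
    thus ?thesis using sums_regroup_root_divisors[OF fB[unfolded B_def]] by (simp add: B_def)
  qed
  define a where "a m = m ^ q" for m :: nat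
  define W where "W m = (\<Sum>n. osc (Suc n * a m) s / of_nat (Suc n) ^ 2 * of_nat (a m) powr (- s - 1))" for m
  have it: "(\<lambda>m. of_nat (Suc m) powr (-s) * (of_nat (a (Suc m)) powr (1 - s) / (s - 1) + of_nat (a (Suc m)) powr (- s) / 2
      + s / 12 * of_nat (a (Suc m)) powr (- s - 1) - K * W (Suc m))) sums infsum f B"
  proof (rule sums_iterated[OF fB[unfolded B_def], folded B_def])
    fix m :: nat assume m: "m \<ge> 1"
    have am: "a m > 0" using m by (simp add: a_def)
    have "(\<lambda>n. of_nat (a m + n) powr (-s)) sums (of_nat (a m) powr (1 - s) / (s - 1) + of_nat (a m) powr (- s) / 2
        + s / 12 * of_nat (a m) powr (- s - 1) - K * W m)"
      using hurwitz_sums[OF s am] unfolding K_def W_def .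
    moreover have "summable (\<lambda>n. norm (of_nat (a m + n) powr (-s) :: complex))"
    proof -
      have "summable (\<lambda>n. real (n + a m) powr - Re s)"
        using s summable_real_powr_iff[of "- Re s"] by (subst summable_iff_shift) simp
      thus ?thesis using am by (simp add: norm_of_nat_powr add.commute del: of_nat_add)
    qed
    ultimately have "((\<lambda>l. of_nat l powr (-s)) has_sum (of_nat (a m) powr (1 - s) / (s - 1) + of_nat (a m) powr (- s) / 2
        + s / 12 * of_nat (a m) powr (- s - 1) - K * W m)) {a m..}"
      by (intro has_sum_atLeast_shift)
    from has_sum_cmult_right[OF this, of "of_nat m powr (-s)"]
    show "((\<lambda>l. f (m, l)) has_sum of_nat m powr (-s) * (of_nat (a m) powr (1 - s) / (s - 1) + of_nat (a m) powr (- s) / 2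
        + s / 12 * of_nat (a m) powr (- s - 1) - K * W m)) {m ^ q..}"
      by (simp add: f_def a_def powr_times_real[of "of_nat _" "of_nat _"] mult_ac)
  qed
  \<comment> \<open>For z = 1 - s, -s and -s - 1 the merged exponent is q - ks, -ks and -q - ks: the
    three zeta arguments of the formula, negated.\<close>
  have pw: "of_nat (Suc m) powr (-s) * of_nat (a (Suc m)) powr z = of_nat (Suc m) powr (of_nat q * z - s)" for m z
    unfolding a_def by (subst of_nat_power_powr) (simp_all add: powr_add[symmetric] del: of_nat_Suc)
  have kq: "of_nat k = (of_nat q + 1 :: complex)" by (simp add: k_def)
  have q': "real q * Re s > real q" using q s by auto
  have "Re (of_nat q * (1 - s) - s) = real q - real q * Re s - Re s"
    "Re (of_nat q * (- s) - s) = - real q * Re s - Re s"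
    "Re (of_nat q * (- s - 1) - s) = - real q * Re s - real q - Re s"
    by (simp_all add: algebra_simps)
  hence less: "Re (of_nat q * (1 - s) - s) < -1" "Re (of_nat q * (- s) - s) < -1" "Re (of_nat q * (- s - 1) - s) < -1"
    using s q' by linarith+
  have t1: "(\<lambda>m. of_nat (Suc m) powr (-s) * of_nat (a (Suc m)) powr (1 - s)) sums zeta (of_nat k * s - of_nat q)"
    unfolding pw using zeta_sums'[OF less(1)] by (simp add: kq algebra_simps)
  have t2: "(\<lambda>m. of_nat (Suc m) powr (-s) * of_nat (a (Suc m)) powr (- s)) sums zeta (of_nat k * s)"
    unfolding pw using zeta_sums'[OF less(2)] by (simp add: kq algebra_simps)
  have t3: "(\<lambda>m. of_nat (Suc m) powr (-s) * of_nat (a (Suc m)) powr (- s - 1)) sums zeta (of_nat k * s + of_nat q)"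
    unfolding pw using zeta_sums'[OF less(3)] by (simp add: kq algebra_simps)
  have t4: "(\<lambda>m. of_nat (Suc m) powr (-s) * W (Suc m)) sums
     (\<Sum>n. sigma_pow q (of_nat q - of_nat k * s) (Suc n) / of_nat (Suc n) ^ 2 * osc (Suc n) s)"
  proof -
    define h :: "nat \<times> nat \<Rightarrow> complex" where
      "h = (\<lambda>(m, n). of_nat m powr (-s) * (osc (n * a m) s / of_nat n ^ 2 * of_nat (a m) powr (- s - 1)))"
    have hle: "norm (h (m, n)) \<le> real m powr - Re s * (1 / real n ^ 2)" if m: "m \<ge> 1" for m n
    proof -
      have am: "a m \<ge> 1" using m by (simp add: a_def)
      have "norm (osc (n * a m) s) \<le> 1 / (Re s + 1)" by (rule norm_osc_le) (use s in auto)
      also have "\<dots> \<le> 1" using s by simp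
      finally have o: "norm (osc (n * a m) s) \<le> 1" .
      have "real (a m) powr (- Re s - 1) \<le> real (a m) powr 0"
        using am s by (intro powr_mono) auto
      hence "norm (of_nat (a m) powr (- s - 1) :: complex) \<le> 1"
        using am by (subst norm_of_nat_powr) auto
      hence "norm (osc (n * a m) s / of_nat n ^ 2 * of_nat (a m) powr (- s - 1)) \<le> (1 / real n ^ 2) * 1"
        unfolding norm_mult norm_divide norm_power norm_of_nat
        using o by (intro mult_mono divide_right_mono) auto
      hence "norm (of_nat m powr (-s) :: complex) * norm (osc (n * a m) s / of_nat n ^ 2 * of_nat (a m) powr (- s - 1)) \<le> real m powr - Re s * (1 / real n ^ 2)"
        using m by (intro mult_mono) (auto simp: norm_of_nat_powr)
      thus ?thesis unfolding h_def prod.case norm_mult[of "of_nat m powr (-s)"] .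
    qed
    have hs: "(h has_sum infsum h ({1..} \<times> {1..})) ({1..} \<times> {1..})"
      by (rule has_sum_product_majorant[OF sr _ summable_inverse_squares_Suc]) (use hle in auto)
    have 1: "(\<lambda>m. of_nat (Suc m) powr (-s) * W (Suc m)) sums infsum h ({1..} \<times> {1..})"
    proof (rule sums_iterated[OF hs])
      fix m :: nat assume m: "m \<ge> 1"
      have am: "a m > 0" using m by (simp add: a_def)
      have "summable (\<lambda>n. norm (h (m, 1 + n)))"
        by (rule summable_comparison_test'[OF summable_mult[OF summable_inverse_squares_Suc, of "real m powr - Re s"]])
           (use hle[OF m, of "Suc _"] in auto)
      moreover have "(\<lambda>n. osc (Suc n * a m) s / of_nat (Suc n) ^ 2 * of_nat (a m) powr (- s - 1)) sums W m"
        unfolding W_def by (rule sums_summable[OF cos_series_powr_sums[OF _ am], THEN summable_sums]) (use s in simp)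
      hence "(\<lambda>n. h (m, 1 + n)) sums (of_nat m powr (-s) * W m)"
        unfolding h_def prod.case plus_1_eq_Suc by (rule sums_mult)
      ultimately show "((\<lambda>n. h (m, n)) has_sum of_nat m powr (-s) * W m) {1..}"
        by (intro has_sum_atLeast_shift)
    qed
    \<comment> \<open>With N = n d^q, n^(-2) = d^(2q) N^(-2). The exponent of d becomes -s - q(s+1)
      + 2q = q - ks, which is the lower index of the divisor function.\<close>
    have summand: "h (d, N div d ^ q) = of_nat d powr (of_nat q - of_nat k * s) * (osc N s / of_nat N ^ 2)"
      if "d > 0" "d ^ q dvd N" "N > 0" for d N
    proof -
      obtain n where N: "N = d ^ q * n" using \<open>d ^ q dvd N\<close> by (rule dvdE)
      have n: "n > 0" using that N by (auto intro: Nat.gr0I)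
      have "(of_nat d :: complex) powr (of_nat q - of_nat k * s) = of_nat d powr (- s) * of_nat d powr (of_nat q * (- s - 1)) * of_nat d powr (of_nat (q * 2))"
        unfolding powr_add[symmetric] by (simp add: kq algebra_simps)
      also have "(of_nat d :: complex) powr (of_nat (q * 2)) = (of_nat d ^ q) ^ 2"
        using that by (subst powr_nat') (auto simp: power_mult)
      also have "(of_nat d :: complex) powr (of_nat q * (- s - 1)) = of_nat (a d) powr (- s - 1)"
        unfolding a_def by (rule of_nat_power_powr[symmetric]) (rule that)
      finally have e: "(of_nat d :: complex) powr (of_nat q - of_nat k * s) = of_nat d powr (- s) * of_nat (a d) powr (- s - 1) * (of_nat d ^ q) ^ 2" .
      have nd: "N div d ^ q = n" using that N by simp
      have na: "n * a d = N" by (simp add: N a_def)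
      show ?thesis unfolding e h_def prod.case nd na
        using that n by (simp add: N power_mult_distrib)
    qed
    have "(\<lambda>N. \<Sum>d | d > 0 \<and> d ^ q dvd Suc N. h (d, Suc N div d ^ q)) sums infsum h ({1..} \<times> {1..})"
      by (rule sums_regroup_power_divisors[OF q hs])
    also have "(\<lambda>N. \<Sum>d | d > 0 \<and> d ^ q dvd Suc N. h (d, Suc N div d ^ q)) =
       (\<lambda>N. sigma_pow q (of_nat q - of_nat k * s) (Suc N) / of_nat (Suc N) ^ 2 * osc (Suc N) s)"
    proof
      fix N
      have "(\<Sum>d | d > 0 \<and> d ^ q dvd Suc N. h (d, Suc N div d ^ q)) =
        (\<Sum>d | d > 0 \<and> d ^ q dvd Suc N. of_nat d powr (of_nat q - of_nat k * s) * (osc (Suc N) s / of_nat (Suc N) ^ 2))"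
        by (rule sum.cong) (use summand in auto)
      also have "\<dots> = sigma_pow q (of_nat q - of_nat k * s) (Suc N) * (osc (Suc N) s / of_nat (Suc N) ^ 2)"
        unfolding sigma_pow_def by (rule sum_distrib_right[symmetric])
      finally show "(\<Sum>d | d > 0 \<and> d ^ q dvd Suc N. h (d, Suc N div d ^ q)) =
         sigma_pow q (of_nat q - of_nat k * s) (Suc N) / of_nat (Suc N) ^ 2 * osc (Suc N) s" by simp
    qed
    finally show ?thesis using 1 by (simp add: sums_iff)
  qed
  have "(\<lambda>m. of_nat (Suc m) powr (-s) * of_nat (a (Suc m)) powr (1 - s) / (s - 1) + of_nat (Suc m) powr (-s) * of_nat (a (Suc m)) powr (- s) / 2
      + s / 12 * (of_nat (Suc m) powr (-s) * of_nat (a (Suc m)) powr (- s - 1)) - K * (of_nat (Suc m) powr (-s) * W (Suc m))) sums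
      (zeta (of_nat k * s - of_nat q) / (s - 1) + zeta (of_nat k * s) / 2 + s / 12 * zeta (of_nat k * s + of_nat q)
       - K * (\<Sum>n. sigma_pow q (of_nat q - of_nat k * s) (Suc n) / of_nat (Suc n) ^ 2 * osc (Suc n) s))"
    by (intro sums_diff sums_add sums_mult sums_divide t1 t2 t3 t4)
  also have "(\<lambda>m. of_nat (Suc m) powr (-s) * of_nat (a (Suc m)) powr (1 - s) / (s - 1) + of_nat (Suc m) powr (-s) * of_nat (a (Suc m)) powr (- s) / 2
      + s / 12 * (of_nat (Suc m) powr (-s) * of_nat (a (Suc m)) powr (- s - 1)) - K * (of_nat (Suc m) powr (-s) * W (Suc m)))
    = (\<lambda>m. of_nat (Suc m) powr (-s) * (of_nat (a (Suc m)) powr (1 - s) / (s - 1) + of_nat (a (Suc m)) powr (- s) / 2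
      + s / 12 * of_nat (a (Suc m)) powr (- s - 1) - K * W (Suc m)))"
    by (rule ext) (simp add: distrib_left right_diff_distrib mult_ac del: of_nat_Suc)
  finally have "infsum f B = zeta (of_nat k * s - of_nat q) / (s - 1) + zeta (of_nat k * s) / 2 + s / 12 * zeta (of_nat k * s + of_nat q)
       - K * (\<Sum>n. sigma_pow q (of_nat q - of_nat k * s) (Suc n) / of_nat (Suc n) ^ 2 * osc (Suc n) s)"
    using it sums_unique2 by blast
  with lhs show ?thesis unfolding K_def by (simp add: add_ac)
qed

section \<open>Continuation of the divisor series\<close>

lemma norm_sigma_pow_le: "norm (sigma_pow q z N) \<le> (\<Sum>d | d > 0 \<and> d ^ q dvd N. real d powr Re z)"
  unfolding sigma_pow_def by (rule sum_norm_le) (auto simp: norm_of_nat_powr)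

text \<open>Crude: at most N admissible d, each at most N. It suffices once a high power of N stands
  in the denominator.\<close>

lemma norm_sigma_pow_le_power:
  assumes q: "q \<ge> 1" and N: "N > 0" and z: "Re z \<le> real E"
  shows "norm (sigma_pow q z N) \<le> real N ^ Suc E"
proof -
  let ?D = "{d. d > 0 \<and> d ^ q dvd N}"
  have le: "d \<le> N" if "d \<in> ?D" for d
    using power_dvd_imp_le[OF q N] that by simp
  have "norm (sigma_pow q z N) \<le> (\<Sum>d\<in>?D. real d powr Re z)" by (rule norm_sigma_pow_le)
  also have "\<dots> \<le> (\<Sum>d\<in>?D. real N ^ E)"
  proof (rule sum_mono)
    fix d assume d: "d \<in> ?D"
    have "real d powr Re z \<le> real d powr real E" using d z by (intro powr_mono) auto
    also have "\<dots> = real d ^ E" using d by (simp add: powr_realpow)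
    also have "\<dots> \<le> real N ^ E" using le[OF d] by (intro power_mono) auto
    finally show "real d powr Re z \<le> real N ^ E" .
  qed
  also have "\<dots> = real (card ?D) * real N ^ E" by simp
  also have "\<dots> \<le> real N * real N ^ E"
  proof (intro mult_right_mono)
    have "?D \<subseteq> {1..N}" using le by (auto simp: Suc_le_eq)
    from card_mono[OF _ this] show "real (card ?D) \<le> real N" by simp
  qed simp
  finally show ?thesis by simp
qed

text \<open>With N = d^q n this is the double series of d^(r - 2q) n^(-2), and the bound on r is
  what makes the sum over d converge. The crude bound for each single N would not be enough near Re
  s = 0.\<close>

lemma summable_divisor_powr_sum:
  assumes q: "q \<ge> 1" and r: "r < 2 * real q - 1"
  shows "summable (\<lambda>N. (\<Sum>d | d > 0 \<and> d ^ q dvd Suc N. real d powr r) / real (Suc N) ^ 2)"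
proof -
  define h :: "nat \<times> nat \<Rightarrow> real" where "h = (\<lambda>(m, n). real m powr (r - 2 * real q) * (1 / real n ^ 2))"
  have "summable (\<lambda>n. real (Suc n) powr (r - 2 * real q))"
    using summable_inverse_powr_Suc[of "2 * real q - r"] r by simp
  hence hs: "(h has_sum infsum h ({1..} \<times> {1..})) ({1..} \<times> {1..})"
    by (rule has_sum_product_majorant[OF _ _ summable_inverse_squares_Suc]) (auto simp: h_def)
  have "(\<Sum>d | d > 0 \<and> d ^ q dvd Suc N. h (d, Suc N div d ^ q)) = (\<Sum>d | d > 0 \<and> d ^ q dvd Suc N. real d powr r) / real (Suc N) ^ 2" for N
    unfolding sum_divide_distrib
  proof (rule sum.cong)
    fix d assume "d \<in> {d. d > 0 \<and> d ^ q dvd Suc N}"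
    hence d: "d > 0" "d ^ q dvd Suc N" by auto
    then obtain n where N: "Suc N = d ^ q * n" by (auto elim: dvdE)
    have "real d powr (2 * real q) = (real d ^ q) ^ 2"
      using d powr_realpow[of "real d" "q * 2"] by (simp add: power_mult mult.commute)
    hence "real d powr (r - 2 * real q) = real d powr r / (real d ^ q) ^ 2"
      by (simp add: powr_diff)
    thus "h (d, Suc N div d ^ q) = real d powr r / real (Suc N) ^ 2"
      using d by (simp add: h_def N power_mult_distrib del: of_nat_Suc)
  qed simp
  with sums_regroup_power_divisors[OF q hs] show ?thesis by (simp add: sums_iff)
qed

text \<open>With N = d^q n, the term d^z N^(-w) splits as d^(z - qw) n^(-w), so the double series
  factors. The n-factor does not involve z and stays a series; only the d-factor has to be
  continued.\<close>

lemma sigma_pow_dirichlet_sums: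
  fixes q w :: nat and z :: complex
  assumes q: "q \<ge> 1" and w: "w \<ge> 2" and z: "Re z - real q * real w < -1"
  shows "(\<lambda>N. sigma_pow q z (Suc N) / of_nat (Suc N) ^ w) sums
    ((\<Sum>n. 1 / of_nat (Suc n) ^ w) * zeta (of_nat q * of_nat w - z))"
proof -
  define y where "y = z - of_nat q * of_nat w"
  define h :: "nat \<times> nat \<Rightarrow> complex" where "h = (\<lambda>(m, n). of_nat m powr y * (1 / of_nat n ^ w))"
  have y: "Re y < -1" using z by (simp add: y_def)
  have vle: "norm (1 / of_nat n ^ w :: complex) \<le> 1 / real n ^ 2" if "n \<ge> 1" for n
    using that w by (simp add: norm_divide norm_power) (intro divide_left_mono power_increasing, auto)
  have vs: "summable (\<lambda>n. norm (1 / of_nat (Suc n) ^ w :: complex))"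
    by (rule summable_comparison_test'[OF summable_inverse_squares_Suc]) (use vle[of "Suc _"] in simp)
  have us: "summable (\<lambda>n. real (Suc n) powr Re y)"
    using summable_inverse_powr_Suc[of "- Re y"] y by simp
  have hs: "(h has_sum infsum h ({1..} \<times> {1..})) ({1..} \<times> {1..})"
  proof (rule has_sum_product_majorant[OF us _ summable_inverse_squares_Suc])
    show "norm (h (m, n)) \<le> real m powr Re y * (1 / real n ^ 2)" if "(m, n) \<in> {1..} \<times> {1..}" for m n
      unfolding h_def prod.case norm_mult using that vle[of n]
      by (intro mult_mono) (auto simp: norm_of_nat_powr)
  qed auto
  have "(\<lambda>m. of_nat (Suc m) powr y * (\<Sum>n. 1 / of_nat (Suc n) ^ w)) sums infsum h ({1..} \<times> {1..})"
  proof (rule sums_iterated[OF hs])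
    fix m :: nat
    have "((\<lambda>n. 1 / of_nat n ^ w :: complex) has_sum (\<Sum>n. 1 / of_nat (Suc n) ^ w)) {1..}"
      by (rule has_sum_atLeast_shift) (use vs summable_norm_cancel[OF vs] in \<open>simp_all add: summable_sums del: of_nat_Suc\<close>)
    from has_sum_cmult_right[OF this, of "of_nat m powr y"]
    show "((\<lambda>n. h (m, n)) has_sum of_nat m powr y * (\<Sum>n. 1 / of_nat (Suc n) ^ w)) {1..}"
      unfolding h_def prod.case .
  qed
  moreover have "(\<lambda>m. of_nat (Suc m) powr y * (\<Sum>n. 1 / of_nat (Suc n) ^ w)) sums (zeta (- y) * (\<Sum>n. 1 / of_nat (Suc n) ^ w))"
    by (intro sums_mult2 zeta_sums' y)
  ultimately have S: "infsum h ({1..} \<times> {1..}) = zeta (- y) * (\<Sum>n. 1 / of_nat (Suc n) ^ w)"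
    by (rule sums_unique2)
  have "(\<Sum>d | d > 0 \<and> d ^ q dvd Suc N. h (d, Suc N div d ^ q)) = sigma_pow q z (Suc N) / of_nat (Suc N) ^ w" for N
    unfolding sigma_pow_def sum_divide_distrib
  proof (rule sum.cong)
    fix d assume "d \<in> {d. d > 0 \<and> d ^ q dvd Suc N}"
    hence d: "d > 0" "d ^ q dvd Suc N" by auto
    then obtain n where N: "Suc N = d ^ q * n" by (auto elim: dvdE)
    have "(of_nat d :: complex) powr (of_nat (q * w)) = (of_nat d ^ q) ^ w"
      using d by (subst powr_nat') (auto simp: power_mult)
    hence "(of_nat d :: complex) powr y = of_nat d powr z / (of_nat d ^ q) ^ w"
      by (simp add: y_def powr_diff)
    thus "h (d, Suc N div d ^ q) = of_nat d powr z / of_nat (Suc N) ^ w"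
      using d by (simp add: h_def N power_mult_distrib del: of_nat_Suc)
  qed simp
  with sums_regroup_power_divisors[OF q hs, unfolded S] show ?thesis
    by (simp add: y_def mult.commute del: of_nat_Suc)
qed

theorem theorem1p2:
  fixes k :: nat and s :: complex
  assumes "k \<ge> 2" and "Re s > 0"
    and "s \<noteq> 1" and "of_nat k * s \<noteq> 1"
  shows "F_cont k s =
      1 / 2 * zeta (of_nat k * s)
    + zeta (of_nat k * s - (of_nat k - 1)) / (s - 1)
    + s / 12 * zeta (of_nat k * s + of_nat k - 1)
    - s * (s + 1) / (2 * of_real pi ^ 2) *
      (\<Sum>n. sigma_pow (k - 1) (of_nat k - 1 - of_nat k * s) (Suc n) / of_nat (Suc n) ^ 2 *
         integral {1..} (\<lambda>x::real.
           of_real (cos (2 * pi * real (Suc n) * x)) * of_real x powr (- s - 2)))"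
proof -
  define q where "q = k - 1"
  have q: "q \<ge> 1" and k: "k = Suc q" using assms(1) by (auto simp: q_def)
  define c where "c n s = sigma_pow q (of_nat q - of_nat k * s) (Suc n)" for n s
  define base where "base s = 1 / 2 * zeta (of_nat k * s) + zeta (of_nat k * s - of_nat q) / (s - 1)
      + s / 12 * zeta (of_nat k * s + of_nat q)" for s
  define K where "K s = s * (s + 1) / (2 * of_real pi ^ 2)" for s :: complex
  define S where "S J s = (\<Sum>n. c n s / of_nat (Suc n) ^ (2*J+2) * osc (Suc n) (s + of_nat (2*J)))" for J s
  \<comment> \<open>Defined through \<open>zeta\<close>, hence meromorphic everywhere; its equality
    with the Dirichlet series is used only for Re s > 1.\<close>
  define D where "D j s = (\<Sum>n. 1 / of_nat (Suc n) ^ (2*j+4)) * zeta (of_nat q * of_nat (2*j+4) - (of_nat q - of_nat k * s))" for j s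
  define R where "R J s = (\<Sum>j<J. osc_coeff j s * ((s + of_nat (2*j+2)) / (4 * of_real pi ^ 2)) * D j s) + osc_coeff J s * S J s" for J s
  \<comment> \<open>Level 0 keeps the oscillating series unexpanded, so the theorem can be read off
    from it; the higher levels serve the continuation.\<close>
  define h where "h A s = base s - K s * (if A = 0 then S 0 s else R (k * A) s)" for A s
  define f where "f s = (\<Sum>j. of_nat (root_divisor_count k (Suc j)) * of_nat (Suc j) powr (-s))" for s :: complex
  have S0_eq: "S 0 s = (\<Sum>n. c n s / of_nat (Suc n) ^ 2 * osc (Suc n) s)" for s
    unfolding S_def by (simp only: mult_0_right add_0_left of_nat_0 add_0_right)
  have chol: "c n holomorphic_on X" for n X
    unfolding c_def sigma_pow_def by (intro holomorphic_intros)

  \<comment> \<open>For the exponent r = q - kb the summability condition r < 2q - 1 reads q + kb >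
    1, true for every b > 0; when q = 1 it is exactly b > 0. Taking b as half of Re s leaves room
    for a disc around \<open>s\<close>.\<close>
  have S0: "S 0 analytic_on {s. Re s > 0}"
    unfolding analytic_on_def
  proof safe
    fix s :: complex assume s: "Re s > 0"
    define b where "b = Re s / 2"
    define M where "M N = (\<Sum>d | d > 0 \<and> d ^ q dvd Suc N. real d powr (real q - real k * b)) / real (Suc N) ^ 2" for N
    have "S 0 holomorphic_on {s. Re s > b}"
      unfolding S_def
    proof (rule osc_series_holomorphic[OF chol])
      have "real k * b > 0" using s k by (simp add: b_def)
      thus "summable M" unfolding M_def using q
        by (intro summable_divisor_powr_sum) (auto simp del: of_nat_Suc)
      show "norm (c n z) / real (Suc n) ^ (2 * 0 + 2) \<le> M n" if z: "Re z > b" for n z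
      proof -
        have "norm (c n z) \<le> (\<Sum>d | d > 0 \<and> d ^ q dvd Suc n. real d powr (real q - real k * Re z))"
          using norm_sigma_pow_le[of q "of_nat q - of_nat k * z" "Suc n"] by (simp add: c_def)
        also have "\<dots> \<le> (\<Sum>d | d > 0 \<and> d ^ q dvd Suc n. real d powr (real q - real k * b))"
          using z by (intro sum_mono powr_mono diff_left_mono mult_left_mono) auto
        finally have "norm (c n z) / real (Suc n) ^ 2 \<le> M n"
          unfolding M_def by (rule divide_right_mono) simp
        thus ?thesis by (simp only: mult_0_right add_0_left)
      qed
    qed (use s in \<open>simp add: b_def\<close>)
    moreover obtain e where "e > 0" "ball s e \<subseteq> {s. Re s > b}"
      by (rule openE[OF open_halfspace_Re_gt[of b], of s]) (use s in \<open>auto simp: b_def\<close>)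
    ultimately show "\<exists>e>0. S 0 holomorphic_on ball s e"
      using holomorphic_on_subset by blast
  qed

  \<comment> \<open>Where Re s > -A, the exponent q - ks has real part at most q + kA, so the
    coefficients are at most N^(q + kA + 1). Division by N^(2kA + 2) leaves at most N^(-2), because
    k <= kA. The depth \<open>k * A\<close> reflects the factor k in this exponent.\<close>
  have SJ: "S (k * A) holomorphic_on {s. Re s > - real A}" if A: "A > 0" for A
    unfolding S_def
  proof (rule osc_series_holomorphic[OF chol _ summable_inverse_squares_Suc])
    have "A \<le> 2 * (k * A)" by (simp add: k)
    thus "- real A + real (2 * (k * A)) \<ge> 0" by linarith
    fix n s assume s: "Re s > - real A"
    define E where "E = q + k * A"
    have "real k * (- real A) \<le> real k * Re s" using s by (intro mult_left_mono) auto
    hence "norm (c n s) \<le> real (Suc n) ^ Suc E"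
      unfolding c_def by (intro norm_sigma_pow_le_power q) (simp_all add: E_def)
    moreover have "Suc E + 2 \<le> 2 * (k * A) + 2"
    proof -
      have "k * 1 \<le> k * A" using A by (intro mult_left_mono) auto
      thus ?thesis unfolding E_def using k by linarith
    qed
    hence "real (Suc n) ^ (Suc E + 2) \<le> real (Suc n) ^ (2 * (k * A) + 2)"
      by (rule power_increasing) simp
    ultimately have "norm (c n s) / real (Suc n) ^ (2 * (k * A) + 2) \<le> real (Suc n) ^ Suc E / real (Suc n) ^ (Suc E + 2)"
      by (intro frac_le) (auto simp del: of_nat_Suc power_Suc)
    also have "\<dots> = 1 / real (Suc n) ^ 2"
      unfolding power_add by (simp del: of_nat_Suc power_Suc)
    finally show "norm (c n s) / real (Suc n) ^ (2 * (k * A) + 2) \<le> 1 / real (Suc n) ^ 2" .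
  qed

  have zmer: "(\<lambda>s. zeta (a * s + b)) meromorphic_on X" for a b X
    by (rule meromorphic_on_compose[of zeta UNIV])
       (use zeta_nicely_meromorphic in \<open>auto simp: nicely_meromorphic_on_def intro!: analytic_intros\<close>)
  have zan: "(\<lambda>s. zeta (a * s + b)) analytic_on {s}" if "a * s + b \<noteq> 1" for a b s
  proof -
    have "(\<lambda>s. a * s + b) analytic_on {s}" by (intro analytic_intros)
    from analytic_on_compose_gen[OF this zeta_analytic[OF that]]
    show ?thesis by (simp add: o_def)
  qed

  have base_mer: "base meromorphic_on X" for X
    unfolding base_def using zmer[of "of_nat k" 0] zmer[of "of_nat k" "- of_nat q"] zmer[of "of_nat k" "of_nat q"]
    by (intro meromorphic_intros) auto
  have D_mer: "D j meromorphic_on X" for j X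
  proof -
    have "D j = (\<lambda>s. (\<Sum>n. 1 / of_nat (Suc n) ^ (2*j+4)) * zeta (of_nat k * s + (of_nat q * of_nat (2*j+4) - of_nat q)))"
      by (rule ext) (simp add: D_def algebra_simps)
    thus ?thesis using zmer by (auto intro!: meromorphic_intros)
  qed
  have hmer: "h A meromorphic_on {s. Re s > - real A}" for A
  proof (cases "A = 0")
    case True
    have "S 0 meromorphic_on {s. Re s > - real A}"
      using S0 True by (intro analytic_on_imp_meromorphic_on) simp
    thus ?thesis using True unfolding h_def K_def
      by (auto intro!: meromorphic_intros base_mer)
  next
    case False
    have "S (k * A) meromorphic_on {s. Re s > - real A}"
      using SJ[of A] False
      by (intro analytic_on_imp_meromorphic_on) (simp add: analytic_on_open open_halfspace_Re_gt)
    moreover have "osc_coeff j meromorphic_on {s. Re s > - real A}" for j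
      using osc_coeff_holomorphic
      by (intro analytic_on_imp_meromorphic_on) (simp add: analytic_on_open open_halfspace_Re_gt)
    ultimately show ?thesis using False unfolding h_def K_def R_def
      by (auto intro!: meromorphic_intros base_mer D_mer)
  qed

  have f: "f s = base s - K s * S 0 s" if "Re s > 1" for s
    using root_divisor_series_eq[OF q that] by (simp add: f_def base_def K_def S0_eq c_def k sums_iff del: of_nat_Suc)
  have hf: "h A s = f s" if s: "Re s > 1" for A s
  proof -
    \<comment> \<open>The exponent of the divisor function is now nonpositive, so the crude bound
      with E = 0 gives coefficients at most N, which the fourth power absorbs.\<close>
    have neg: "real q - real k * Re s \<le> 0"
    proof -
      have "real k * 1 \<le> real k * Re s" using s by (intro mult_left_mono) auto
      moreover have "real k = real q + 1" by (simp add: k)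
      ultimately show ?thesis by linarith
    qed
    have "summable (\<lambda>n. norm (c n s) / real (Suc n) ^ 4)"
    proof (rule summable_comparison_test'[OF summable_inverse_squares_Suc])
      fix n
      have "norm (c n s) \<le> real (Suc n) ^ Suc 0"
        unfolding c_def by (intro norm_sigma_pow_le_power q) (use neg in auto)
      hence "norm (c n s) / real (Suc n) ^ 4 \<le> real (Suc n) ^ 2 / real (Suc n) ^ 4"
        by (intro divide_right_mono order_trans[OF _ power_increasing[of "Suc 0" 2 "real (Suc n)"]]) auto
      also have "\<dots> = 1 / real (Suc n) ^ 2"
        by (simp add: power2_eq_square power4_eq_xxxx del: of_nat_Suc)
      finally show "norm (norm (c n s) / real (Suc n) ^ 4) \<le> 1 / real (Suc n) ^ 2" by simp
    qed
    moreover have "D j s = (\<Sum>n. c n s / of_nat (Suc n) ^ (2*j+4))" for j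
    proof -
      have "real q * 2 \<le> real q * real (2*j+4)" by (intro mult_left_mono) auto
      hence "real q - real k * Re s - real q * real (2*j+4) < - 1" using neg q by linarith
      thus ?thesis
        unfolding c_def D_def by (intro sums_unique sigma_pow_dirichlet_sums q) simp_all
    qed
    ultimately have "R J s = S 0 s" for J
      using osc_series_expand[of s "\<lambda>n. c n s" J] s
      unfolding R_def S0_eq by (simp add: S_def sums_iff del: of_nat_Suc)
    thus ?thesis by (simp add: f[OF s] h_def)
  qed

  \<comment> \<open>The zeta arguments avoid 1: ks by hypothesis, ks - q because it equals 1 only at
    s = 1, and ks + q because its real part exceeds 1.\<close>
  have an: "h 0 analytic_on {s}" if "Re s > 0" "s \<noteq> 1" "of_nat k * s \<noteq> 1" for s
  proof -
    have "of_nat k * s + - of_nat q \<noteq> 1"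
    proof
      assume "of_nat k * s + - of_nat q = 1"
      hence "of_nat k * s = of_nat k * 1" by (simp add: k algebra_simps)
      moreover have "(of_nat k :: complex) \<noteq> 0" unfolding of_nat_eq_0_iff using assms(1) by simp
      ultimately show False using that by (simp only: mult_cancel_left simp_thms)
    qed
    moreover have "of_nat k * s + of_nat q \<noteq> 1"
    proof
      assume "of_nat k * s + of_nat q = 1"
      hence "Re (of_nat k * s + of_nat q) = 1" by simp
      moreover have "real k * Re s > 0" using that k by simp
      ultimately show False using q by simp
    qed
    ultimately have "base analytic_on {s}"
      unfolding base_def
      using zan[of "of_nat k" s 0] zan[of "of_nat k" s "- of_nat q"] zan[of "of_nat k" s "of_nat q"] that
      by (intro analytic_intros) auto
    moreover have "S 0 analytic_on {s}"
      by (rule analytic_on_subset[OF S0]) (use that in auto)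
    ultimately show ?thesis unfolding h_def K_def by (auto intro!: analytic_intros)
  qed

  obtain g where g: "g nicely_meromorphic_on UNIV"
    "\<And>n s. Re s > - real n \<Longrightarrow> h n analytic_on {s} \<Longrightarrow> g s = h n s"
    by (rule nicely_meromorphic_glue[OF hmer hf]) (assumption, rule that)
  have gf: "g s = f s" if s: "Re s > 1" for s
  proof -
    have "real k * Re s \<ge> 1 * Re s" using s assms(1) by (intro mult_right_mono) auto
    hence "real k * Re s \<noteq> 1" using s by linarith
    hence "Re (of_nat k * s) \<noteq> 1" by simp
    hence "of_nat k * s \<noteq> 1" by fastforce
    moreover have "s \<noteq> 1" using s by auto
    ultimately have "h 0 analytic_on {s}" using an[of s] s by simp
    thus ?thesis using g(2)[of 0 s] hf[OF s] s by simp
  qed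
  \<comment> \<open>Uniqueness needs only the values for Re s > 1. At the given \<open>s\<close> the
    value of \<open>g\<close> is then that of \<open>h 0\<close>, since \<open>h 0\<close> is
    analytic there.\<close>
  have "F_cont k = g"
    unfolding F_cont_def
    by (rule meromorphic_continuation_unique[OF g(1) open_halfspace_Re_gt])
       (use gf in \<open>auto simp: f_def intro: exI[of _ 2]\<close>)
  hence "F_cont k s = base s - K s * S 0 s"
    using g(2)[of 0 s] an[of s] assms by (simp add: h_def)
  moreover have "of_nat k - 1 = (of_nat q :: complex)" "k - 1 = q" by (simp_all add: k)
  ultimately show ?thesis
    unfolding base_def K_def S0_eq c_def osc_def by (simp add: add_diff_eq[symmetric] del: of_nat_Suc)
qed

end
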